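(* Let $d$ be a real number and $b\ge 0$ an integer, and let $F=F_{d,b}$ be a basic sequence with pair $(d,b)$, i.e. a real sequence with $F(n)=n^d\log^b n$ for all $n\ge 2$. Let $\ell:=\sigma(d)$, where $\sigma(d)=1$ if $d<0$ and $\sigma(d)=2+\lfloor d\rfloor$ if $d\ge 0$. Let $\Pi[F]$ be the sequence $$\Pi[F](n)=\sum_{k=0}^n(-1)^k\binom nk F(k).$$ Then the analytic continuation $\Psi(s)$ of the sequence $\Pi[F]$ is of polynomial growth on any halfplane $\Re s\ge a>d$. Moreover, $\Psi$ is tame at $s=d$, and, for some $\sigma_0\in\,]0,1[$, it is written on the halfplane $\Re s>d-\sigma_0$ as $$\Psi(s)=\left[s(s-1)\cdots(s-\ell+1)\sum_{m=0}^b a_m\,\Gamma_\ell^{(m)}(s-d)\right]+B(s).$$ Here $B(s)$ is of polynomial growth, $\Gamma_\ell^{(m)}$ is the $m$-th derivative of the twisted $\Gamma$ function, and the coefficients $a_m$ are expressed with the derivatives of order $k\le b$ of the function $s\mapsto 1/\Gamma(s)$ at $s=\ell-d$.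
   Context: Analytic continuation (lifting) of $\Pi[F]$: the function $\Psi$, analytic on $\Re s>d$, given there by the Newton interpolation series $\Psi(s)=\sum_{k\ge0}(-1)^k\frac{F(k)}{k!}\,s(s-1)\cdots(s-k+1)$; it satisfies $\Psi(n)=\Pi[F](n)$ at the integers $n\ge0$ of this halfplane. It is continued to the left of $\Re s=d$ where possible, and the same letter $\Psi$ is used. Twisted Gamma function and its derivatives: for integers $m\ge0$, $\ell\ge1$ and $\Re s>0$, $$\Gamma_\ell^{(m)}(s):=\int_0^\infty e^{-\ell u}u^{s-1}\log^m u\,du,$$ extended meromorphically to the left, with a pole of order $m+1$ at $s=0$. Polynomial growth: a function $\varpi$ defined on an unbounded domain $\Omega\subset\mathbb C$ is of polynomial growth if there exists $r$ for which $|\varpi(s)|=O(|s|^r)$ as $s\to\infty$ on $\Omega$. When $\Omega$ is included in a vertical strip this means $|\varpi(s)|=O(|\Im s|^r)$. Tameness: a function $\varpi$, analytic and of polynomial growth on $\Re s>c$, is tame at $s=c$ if one of the following three properties holds (in each, $\beta+1\ge1$ denotes the order of the pole at $c$). (S-shape) There is $\delta>0$ such that on $\Re s>c-\delta$ the function $\varpi$ is meromorphic, has a sole pole (of order $\beta+1\ge1$) at $s=c$, and is of polynomial growth as $|\Im s|\to+\infty$. (H-shape) There are $A,D,\rho>0$ such that on the region $\{\sigma+it:\ |t|\ge D,\ \sigma>c-A|t|^{-\rho}\}\cup\{\sigma+it:\ |t|\le D,\ \sigma>c-AD^{-\rho}\}$ the function $\varpi$ is meromorphic, has a sole pole (of order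 $\beta+1$) at $s=c$, and is of polynomial growth as $|\Im s|\to+\infty$. (P-shape) There are $\delta>0$ and $t\ne0$ such that on $\Re s>c-\delta$ the function $\varpi$ is meromorphic, has only a pole (of order $\beta+1\ge1$) at $s=c$ and a family of simple poles at the points $s_k=c+2ki\pi t$, $k\in\mathbb Z\setminus\{0\}$, and is of polynomial growth as $|\Im s|\to+\infty$; more precisely, it is of polynomial growth on a family of horizontal lines $\Im s=t_k$ with $t_k\to\infty$ and on vertical lines $\Re s=c-\delta'$ with some $\delta'<\delta$.
   Formalization: For b=0 and d a nonnegative integer, Ψ has no pole at d, so "tame at s=d" is replaced by analytic continuation of polynomial growth to some Re s>d−δ; "B(s) is of polynomial growth" is stated on vertical strips d−σ₀<Re s≤x, as it fails on the whole halfplane. *)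

theory Defs
  imports "HOL-Complex_Analysis.Complex_Analysis" "HOL-Library.Landau_Symbols"
begin

abbreviation right_halfplane :: "real \<Rightarrow> complex set" where
  "right_halfplane c \<equiv> {s. Re s > c}"

definition falling :: "complex \<Rightarrow> nat \<Rightarrow> complex" where
  "falling s k = (\<Prod>i<k. s - of_nat i)"


subsection \<open>Sequences and their Newton lifting\<close>

text \<open>The values at 0 and 1 are not constrained.\<close>

definition basic_sequence :: "real \<Rightarrow> nat \<Rightarrow> (nat \<Rightarrow> real) \<Rightarrow> bool" where
  "basic_sequence d b F \<longleftrightarrow> (\<forall>n\<ge>2. F n = real n powr d * ln (real n) ^ b)"

definition sigma_deg :: "real \<Rightarrow> nat" where
  "sigma_deg d = (if d < 0 then 1 else nat (2 + \<lfloor>d\<rfloor>))"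

definition Pi_seq :: "(nat \<Rightarrow> real) \<Rightarrow> nat \<Rightarrow> real" where
  "Pi_seq F n = (\<Sum>k\<le>n. (-1) ^ k * real (n choose k) * F k)"

text \<open>Convergence of the Newton series is part of the definition. The values of \<open>\<Psi>\<close> outside
  the halfplane are left open, so that \<open>\<Psi>\<close> may also stand for a continuation to the left.\<close>

definition newton_lifting :: "(nat \<Rightarrow> real) \<Rightarrow> real \<Rightarrow> (complex \<Rightarrow> complex) \<Rightarrow> bool" where
  "newton_lifting F d \<Psi> \<longleftrightarrow>
     \<Psi> holomorphic_on right_halfplane d \<and>
     (\<forall>s\<in>right_halfplane d.
        (\<lambda>k. (-1) ^ k * (of_real (F k) / fact k) * falling s k) sums \<Psi> s) \<and>
     (\<forall>n::nat. real n > d \<longrightarrow> \<Psi> (of_nat n) = of_real (Pi_seq F n))"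


subsection \<open>Twisted Gamma function\<close>

text \<open>Being holomorphic off the nonpositive integers determines the continuation uniquely there;
  its values at the nonpositive integers are arbitrary.\<close>

definition is_twisted_Gamma :: "nat \<Rightarrow> nat \<Rightarrow> (complex \<Rightarrow> complex) \<Rightarrow> bool" where
  "is_twisted_Gamma l m G \<longleftrightarrow>
     G meromorphic_on UNIV \<and> G holomorphic_on (- \<int>\<^sub>\<le>\<^sub>0) \<and>
     (\<forall>s. Re s > 0 \<longrightarrow>
        set_integrable lborel {0<..}
          (\<lambda>u. of_real (exp (- (real l * u))) * of_real u powr (s - 1) * of_real (ln u ^ m)) \<and>
        G s = (LINT u:{0<..}|lborel.
          of_real (exp (- (real l * u))) * of_real u powr (s - 1) * of_real (ln u ^ m)))"

definition twisted_Gamma :: "nat \<Rightarrow> nat \<Rightarrow> complex \<Rightarrow> complex" where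
  "twisted_Gamma l m = (SOME G. is_twisted_Gamma l m G)"


subsection \<open>Polynomial growth\<close>

definition poly_growth_on :: "(complex \<Rightarrow> complex) \<Rightarrow> complex set \<Rightarrow> bool" where
  "poly_growth_on f S \<longleftrightarrow>
     (\<exists>r::real. f \<in> O[inf at_infinity (principal S)](\<lambda>s. of_real (norm s powr r)))"

text \<open>The variant for the limit \<open>\<bar>Im s\<bar> \<rightarrow> \<infinity>\<close>, uniformly in \<open>Re s\<close>.\<close>

definition poly_growth_Im_on :: "(complex \<Rightarrow> complex) \<Rightarrow> complex set \<Rightarrow> bool" where
  "poly_growth_Im_on f S \<longleftrightarrow>
     (\<exists>r::real. f \<in> O[inf (filtercomap (\<lambda>s. \<bar>Im s\<bar>) at_top) (principal S)](\<lambda>s. of_real (norm s powr r)))"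


subsection \<open>Tameness\<close>

definition pole_of_order :: "(complex \<Rightarrow> complex) \<Rightarrow> complex \<Rightarrow> nat \<Rightarrow> bool" where
  "pole_of_order f z k \<longleftrightarrow> is_pole f z \<and> zorder f z = - int k"

definition sole_pole_on :: "(complex \<Rightarrow> complex) \<Rightarrow> complex set \<Rightarrow> complex \<Rightarrow> nat \<Rightarrow> bool" where
  "sole_pole_on f S c k \<longleftrightarrow>
     f meromorphic_on S \<and> f holomorphic_on (S - {c}) \<and> pole_of_order f c k"

definition S_shape :: "(complex \<Rightarrow> complex) \<Rightarrow> real \<Rightarrow> nat \<Rightarrow> bool" where
  "S_shape f c \<beta> \<longleftrightarrow>
     (\<exists>\<delta>>0. sole_pole_on f (right_halfplane (c - \<delta>)) (of_real c) (\<beta> + 1) \<and>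
            poly_growth_Im_on f (right_halfplane (c - \<delta>)))"

definition H_region :: "real \<Rightarrow> real \<Rightarrow> real \<Rightarrow> real \<Rightarrow> complex set" where
  "H_region c A D \<rho> =
     {s. \<bar>Im s\<bar> \<ge> D \<and> Re s > c - A * \<bar>Im s\<bar> powr (- \<rho>)} \<union>
     {s. \<bar>Im s\<bar> \<le> D \<and> Re s > c - A * D powr (- \<rho>)}"

definition H_shape :: "(complex \<Rightarrow> complex) \<Rightarrow> real \<Rightarrow> nat \<Rightarrow> bool" where
  "H_shape f c \<beta> \<longleftrightarrow>
     (\<exists>A>0. \<exists>D>0. \<exists>\<rho>>0. sole_pole_on f (H_region c A D \<rho>) (of_real c) (\<beta> + 1) \<and>
            poly_growth_Im_on f (H_region c A D \<rho>))"

definition P_pole :: "real \<Rightarrow> real \<Rightarrow> int \<Rightarrow> complex" where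
  "P_pole c t k = of_real c + 2 * of_int k * \<i> * of_real pi * of_real t"

text \<open>Polynomial growth is required only along lines that avoid the poles: the horizontal lines
  at heights \<open>\<tau> j\<close> and \<open>- \<tau> j\<close>, and one vertical line to the left of \<open>Re s = c\<close>.\<close>

definition P_shape :: "(complex \<Rightarrow> complex) \<Rightarrow> real \<Rightarrow> nat \<Rightarrow> bool" where
  "P_shape f c \<beta> \<longleftrightarrow>
     (\<exists>\<delta>>0. \<exists>t. t \<noteq> 0 \<and>
        f meromorphic_on right_halfplane (c - \<delta>) \<and>
        f holomorphic_on (right_halfplane (c - \<delta>) - range (P_pole c t)) \<and>
        pole_of_order f (of_real c) (\<beta> + 1) \<and>
        (\<forall>k. k \<noteq> 0 \<longrightarrow> pole_of_order f (P_pole c t k) 1) \<and>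
        (\<exists>\<tau>::nat \<Rightarrow> real. filterlim \<tau> at_top sequentially \<and>
           poly_growth_Im_on f {s. Re s > c - \<delta> \<and> \<bar>Im s\<bar> \<in> range \<tau>}) \<and>
        (\<exists>\<delta>'. 0 < \<delta>' \<and> \<delta>' < \<delta> \<and> poly_growth_Im_on f {s. Re s = c - \<delta>'}))"

text \<open>Growth to the right of \<open>c\<close> is required on each closed halfplane \<open>Re s \<ge> a\<close> with \<open>a > c\<close>,
  not uniformly up to the line \<open>Re s = c\<close>: the P-shape has infinitely many poles on that line.
  All three shapes demand a genuine pole at \<open>c\<close>. The Newton lifting of a basic sequence has none at \<open>d\<close>
  when \<open>b = 0\<close> and \<open>d \<in> \<nat>\<close>: up to its values at 0 and 1 the sequence is then a polynomial, and so is
  the lifting.\<close>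

definition tame :: "(complex \<Rightarrow> complex) \<Rightarrow> real \<Rightarrow> bool" where
  "tame f c \<longleftrightarrow>
     f holomorphic_on right_halfplane c \<and>
     (\<forall>a>c. poly_growth_on f {s. Re s \<ge> a}) \<and>
     (\<exists>\<beta>. S_shape f c \<beta> \<or> H_shape f c \<beta> \<or> P_shape f c \<beta>)"


subsection \<open>The coefficients\<close>

text \<open>With \<open>w = l - d\<close>, differentiating \<open>k powr (- w) = rGamma w * (\<integral>u>0. exp (- k * u) * u powr (w - 1))\<close>
  \<open>b\<close> times in \<open>w\<close> by the Leibniz rule gives
  \<open>k powr (- w) * ln k ^ b = (-1) ^ b * (\<Sum>m\<le>b. (b choose m) * (deriv ^^ (b - m)) rGamma w * (\<integral>u>0. exp (- k * u) * u powr (w - 1) * ln u ^ m))\<close>.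
  The remaining sign \<open>(-1) ^ l\<close> comes from shifting the summation index of the Newton series by \<open>l\<close>.\<close>

definition tame_coeff :: "real \<Rightarrow> nat \<Rightarrow> nat \<Rightarrow> complex" where
  "tame_coeff d b m =
     (-1) ^ (sigma_deg d + b) * of_nat (b choose m) *
     (deriv ^^ (b - m)) rGamma (of_real (real (sigma_deg d) - d))"

end

theory Submission
  imports Defs "HOL-Combinatorics.Stirling"
begin

text \<open>
  Put \<open>l = sigma_deg d\<close> and \<open>w = l - d > 0\<close>. Write \<open>k powr d * ln k ^ b\<close> as \<open>k ^ l\<close> times
  \<open>k powr (- w) * ln k ^ b\<close>, expand \<open>k ^ l\<close> in falling factorials with Stirling numbers, and the second
  factor in integrals \<open>\<integral>u>0. exp (- k * u) * u powr (w - 1) * ln u ^ m\<close> by the Leibniz rule. Summing under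
  the integral with the binomial theorem turns the Newton series into a combination of
  \<open>falling s i * (\<integral>u>0. exp (- i * u) * (1 - exp (- u)) powr (s - i) * u powr (w - 1) * ln u ^ m)\<close>
  with \<open>1 \<le> i \<le> l\<close>, valid for \<open>Re s > d\<close>. These integrals converge for \<open>Re s > d - (l - i)\<close>, and
  polynomial bounds are immediate because \<open>0 < 1 - exp (- u) < 1\<close>. Only \<open>i = l\<close> is singular at \<open>d\<close>;
  there, replacing \<open>1 - exp (- u)\<close> by \<open>u\<close> gives the twisted Gamma function at \<open>s - d\<close>, and the
  difference is holomorphic for \<open>Re s > d - 1\<close>.
\<close>

text \<open>The choice of \<open>l\<close> makes \<open>w > 0\<close>, so that
  \<open>k powr (- w)\<close> is a Gamma integral; compensating by \<open>k ^ l\<close> is harmless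
  because falling factorials of \<open>k\<close> cancel against \<open>fact k\<close> and merely
  shift the summation index. As \<open>l >= 1\<close>, no term \<open>i = 0\<close> occurs, and
  \<open>exp (- i * u)\<close> controls all integrals at infinity, so everything is decided near
  \<open>u = 0\<close>. No single representation serves everywhere. The Newton integrals give growth
  on whole halfplanes to the right of \<open>d\<close> but do not reach \<open>d\<close>; the
  splitting into Gamma function and remainder passes \<open>d\<close>, but with bounds only on
  strips of finite width: the Gamma part outgrows every polynomial as \<open>Re s\<close> tends to
  infinity, and \<open>B\<close> must compensate for it. The two are glued along
  \<open>Re s = d + 1\<close>. The width 1/4 of the continuation leaves room for Cauchy estimates on
  derivatives of the regular part of the Gamma function. The polynomial in front of the Gamma
  functions vanishes at \<open>d\<close> exactly when \<open>d\<close> is a natural number; this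
  costs one order of the pole, and removes it altogether when \<open>b = 0\<close>.\<close>

subsection \<open>Holomorphic parameter integrals\<close>

text \<open>Cauchy's inequality turns the bound on \<open>f\<close> into one on its derivative on a
  smaller ball, hence into a Lipschitz bound; so a multiple of \<open>g\<close> dominates the
  difference quotients as well. The factor \<open>(1 + norm z) ^ N\<close>, locally harmless, is
  kept so that the same majorant also yields polynomial growth.\<close>

lemma
  fixes f :: "complex \<Rightarrow> 'a \<Rightarrow> complex"
  assumes "open S" "z \<in> S"
    and hol: "\<And>x. x \<in> space M \<Longrightarrow> (\<lambda>z. f z x) holomorphic_on S"
    and meas: "\<And>z. z \<in> S \<Longrightarrow> f z \<in> borel_measurable M"
    and bound: "\<And>z x. z \<in> S \<Longrightarrow> x \<in> space M \<Longrightarrow> norm (f z x) \<le> (1 + norm z) ^ N * g x"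
    and int: "integrable M g"
  shows integrable_param: "integrable M (f z)"
    and norm_integral_param_le: "norm (\<integral>x. f z x \<partial>M) \<le> (1 + norm z) ^ N * (\<integral>x. g x \<partial>M)"
    and has_field_derivative_integral_param:
      "((\<lambda>z. \<integral>x. f z x \<partial>M) has_field_derivative (\<integral>x. deriv (\<lambda>z. f z x) z \<partial>M)) (at z)"
proof -
  have intf: "integrable M (f w)" if "w \<in> S" for w
  proof (rule Bochner_Integration.integrable_bound)
    show "integrable M (\<lambda>x. (1 + norm w) ^ N * g x)"
      using int by simp
    show "AE x in M. norm (f w x) \<le> norm ((1 + norm w) ^ N * g x)"
      using bound[OF that] by (intro AE_I2) fastforce
  qed (rule meas[OF that])
  then show "integrable M (f z)"
    using assms(2) .
  have "norm (\<integral>x. f z x \<partial>M) \<le> (\<integral>x. (1 + norm z) ^ N * g x \<partial>M)"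
    using intf[OF assms(2)] bound[OF assms(2)] int
    by (intro order_trans[OF integral_norm_bound integral_mono]) auto
  then show "norm (\<integral>x. f z x \<partial>M) \<le> (1 + norm z) ^ N * (\<integral>x. g x \<partial>M)"
    by simp
  obtain r' where r': "r' > 0" "cball z r' \<subseteq> S"
    using assms(1,2) open_contains_cball by metis
  \<comment> \<open>Half the radius: a circle of radius \<open>r\<close> about any point of
    \<open>ball z r\<close> stays in \<open>cball z (2 * r)\<close>, hence in
    \<open>S\<close>.\<close>
  define r where "r = r' / 2"
  have r: "r > 0" "cball z (2 * r) \<subseteq> S"
    using r' by (auto simp: r_def)
  define K where "K = (1 + norm z + 2 * r) ^ N"
  have g_nonneg: "g x \<ge> 0" if "x \<in> space M" for x
  proof -
    have "0 \<le> (1 + norm z) ^ N * g x"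
      using bound[OF assms(2) that] norm_ge_zero order_trans by blast
    moreover have "(1 + norm z) ^ N > 0"
      by (intro zero_less_power) (simp add: add_pos_nonneg)
    ultimately show ?thesis
      by (simp add: zero_le_mult_iff)
  qed
  have fK: "norm (f w x) \<le> K * g x" if "x \<in> space M" "dist z w \<le> 2 * r" for w x
  proof -
    have "w \<in> S"
      using r that by auto
    have "norm w \<le> norm z + norm (w - z)"
      using norm_triangle_sub[of w z] by simp
    then have nw: "norm w \<le> norm z + 2 * r"
      using that by (simp add: dist_norm norm_minus_commute)
    have "norm (f w x) \<le> (1 + norm w) ^ N * g x"
      by (rule bound) fact+
    also have "\<dots> \<le> K * g x"
      unfolding K_def using g_nonneg[OF that(1)] nw
      by (intro mult_right_mono power_mono) auto
    finally show ?thesis .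
  qed
  have sub: "ball w r \<subseteq> S" "cball w r \<subseteq> S" if "w \<in> ball z r" for w
  proof -
    have "dist z y \<le> 2 * r" if "dist w y \<le> r" for y
      using dist_triangle[of z y w] \<open>w \<in> ball z r\<close> that by simp
    then show "ball w r \<subseteq> S" "cball w r \<subseteq> S"
      using r by (force simp: subset_iff)+
  qed
  have dK: "norm (deriv (\<lambda>z. f z x) w) \<le> K * g x / r" if "x \<in> space M" "w \<in> ball z r" for w x
  proof -
    have "norm ((deriv ^^ 1) (\<lambda>z. f z x) w) \<le> fact 1 * (K * g x) / r ^ 1"
    proof (rule Cauchy_inequality)
      show "(\<lambda>z. f z x) holomorphic_on ball w r"
        using hol[OF that(1)] sub[OF that(2)] holomorphic_on_subset by blast
      show "continuous_on (cball w r) (\<lambda>z. f z x)"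
        using hol[OF that(1)] sub[OF that(2)] holomorphic_on_subset holomorphic_on_imp_continuous_on by blast
      fix y assume "norm (w - y) = r"
      then have "dist z y \<le> 2 * r"
        using dist_triangle[of z y w] that(2) by (simp add: dist_norm)
      then show "norm (f y x) \<le> K * g x"
        using fK that(1) by blast
    qed fact
    then show ?thesis by simp
  qed
  have lip: "norm (f w x - f z x) \<le> K * g x / r * norm (w - z)" if "x \<in> space M" "w \<in> ball z r" for w x
  proof (rule field_differentiable_bound[where S = "ball z r"])
    fix y assume y: "y \<in> ball z r"
    then have "y \<in> S" using r by (auto simp: subset_iff)
    then show "((\<lambda>z. f z x) has_field_derivative deriv (\<lambda>z. f z x) y) (at y within ball z r)"
      using hol[OF that(1)] assms(1) holomorphic_derivI by blast
    show "norm (deriv (\<lambda>z. f z x) y) \<le> K * g x / r"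
      by (rule dK) fact+
  qed (use that r in auto)
  let ?q = "\<lambda>y x. (f y x - f z x) / (y - z)"
  have ptw: "((\<lambda>y. ?q y x) \<longlongrightarrow> deriv (\<lambda>z. f z x) z) (at z)" if "x \<in> space M" for x
    using holomorphic_derivI[OF hol[OF that] assms(1,2), of UNIV] by (simp add: has_field_derivative_iff)
  \<comment> \<open>Dominated convergence works along sequences; approaching within
    \<open>ball z r\<close> puts every term where \<open>lip\<close> applies.\<close>
  have lim: "((\<lambda>y. \<integral>x. ?q y x \<partial>M) \<longlongrightarrow> (\<integral>x. deriv (\<lambda>z. f z x) z \<partial>M)) (at z within ball z r)"
    unfolding tendsto_at_iff_sequentially
  proof (intro allI impI)
    fix X assume X: "\<forall>i. X i \<in> ball z r - {z}" "X \<longlonglongrightarrow> z"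
    have conv: "(\<lambda>i. ?q (X i) x) \<longlonglongrightarrow> deriv (\<lambda>z. f z x) z" if "x \<in> space M" for x
    proof -
      have "filterlim X (at z) sequentially"
        using X by (intro filterlim_atI always_eventually) auto
      then show ?thesis
        using filterlim_compose[OF ptw[OF that]] by blast
    qed
    have XS: "X i \<in> S" for i
    proof -
      have "dist z (X i) < r"
        using X(1) by auto
      then have "X i \<in> cball z (2 * r)"
        using r(1) by simp
      then show ?thesis
        using r(2) by blast
    qed
    have measq: "?q (X i) \<in> borel_measurable M" for i
      using meas[OF XS] meas[OF assms(2)] by (intro borel_measurable_divide borel_measurable_diff) auto
    have "(\<lambda>i. \<integral>x. ?q (X i) x \<partial>M) \<longlonglongrightarrow> (\<integral>x. deriv (\<lambda>z. f z x) z \<partial>M)"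
    proof (rule integral_dominated_convergence)
      show "(\<lambda>x. deriv (\<lambda>z. f z x) z) \<in> borel_measurable M"
        by (rule borel_measurable_LIMSEQ_metric[OF measq conv])
      show "integrable M (\<lambda>x. K * g x / r)"
        using int by simp
      show "AE x in M. norm (?q (X i) x) \<le> K * g x / r" for i
        using lip[of _ "X i"] X(1) by (intro AE_I2) (auto simp: norm_divide divide_le_eq)
    qed (use conv measq in auto)
    then show "((\<lambda>y. \<integral>x. ?q y x \<partial>M) \<circ> X) \<longlonglongrightarrow> (\<integral>x. deriv (\<lambda>z. f z x) z \<partial>M)"
      by (simp add: o_def)
  qed
  have eq: "(\<integral>x. ?q y x \<partial>M) = ((\<integral>x. f y x \<partial>M) - (\<integral>x. f z x \<partial>M)) / (y - z)" if "y \<in> S" for y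
    using intf[OF that] intf[OF assms(2)] by simp
  have "((\<lambda>y. ((\<integral>x. f y x \<partial>M) - (\<integral>x. f z x \<partial>M)) / (y - z)) \<longlongrightarrow>
      (\<integral>x. deriv (\<lambda>z. f z x) z \<partial>M)) (at z)"
  proof (rule Lim_transform_within_open)
    show "((\<lambda>y. \<integral>x. ?q y x \<partial>M) \<longlongrightarrow> (\<integral>x. deriv (\<lambda>z. f z x) z \<partial>M)) (at z)"
      using lim unfolding at_within_open[OF iffD2[OF centre_in_ball r(1)] open_ball] .
    fix y assume "y \<in> S" "y \<noteq> z"
    then show "(\<integral>x. ?q y x \<partial>M) = ((\<integral>x. f y x \<partial>M) - (\<integral>x. f z x \<partial>M)) / (y - z)"
      by (intro eq)
  qed fact+
  then show "((\<lambda>z. \<integral>x. f z x \<partial>M) has_field_derivative (\<integral>x. deriv (\<lambda>z. f z x) z \<partial>M)) (at z)"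
    by (simp add: has_field_derivative_iff)
qed

section \<open>Absolutely convergent Gamma-type integrals on the positive half-line\<close>

abbreviation lborel_pos :: "real measure" where
  "lborel_pos \<equiv> restrict_space lborel {0<..}"

lemma space_lborel_pos: "x \<in> space lborel_pos \<longleftrightarrow> 0 < x"
  by (simp add: space_restrict_space)

lemma integrable_exp_powr:
  fixes p c :: real
  assumes "p > 0" "c > 0"
  shows "integrable lborel_pos (\<lambda>u. exp (- (c * u)) * u powr (p - 1))"
proof -
  let ?f = "\<lambda>t. complex_of_real t powr (of_real p - 1) / of_real (exp (c * t))"
  have "?f absolutely_integrable_on {0<..}"
    using absolutely_integrable_Gamma_integral[of "of_real p" c] assms by simp
  then have "integrable lebesgue (\<lambda>x. indicator {0<..} x *\<^sub>R norm (?f x))"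
    using absolutely_integrable_norm unfolding set_integrable_def by fastforce
  also have "(\<lambda>x. indicator {0<..} x *\<^sub>R norm (?f x)) =
      (\<lambda>x. indicator {0<..} x *\<^sub>R (exp (- (c * x)) * x powr (p - 1)))"
    by (auto simp: fun_eq_iff norm_divide norm_powr_real_powr exp_minus field_simps
             split: split_indicator)
  finally show ?thesis
    by (simp add: integrable_restrict_space integrable_completion)
qed

text \<open>Up to the factor \<open>fact m / e ^ m\<close>, the left side is one term of the
  exponential series at \<open>e * |ln u|\<close>, and \<open>exp (e * |ln u|)\<close> is one of the
  two powers. Logarithms thus cost an arbitrarily small change of exponent.\<close>

lemma abs_ln_power_le:
  fixes u e :: real
  assumes "u > 0" "e > 0"
  shows "\<bar>ln u\<bar> ^ m \<le> fact m / e ^ m * (u powr e + u powr (- e))"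
proof -
  have "(e * \<bar>ln u\<bar>) ^ m / fact m \<le> exp (e * \<bar>ln u\<bar>)"
  proof -
    have "(e * \<bar>ln u\<bar>) ^ m / fact m = (\<Sum>n\<in>{m}. (e * \<bar>ln u\<bar>) ^ n / fact n)" by simp
    also have "\<dots> \<le> (\<Sum>n. (e * \<bar>ln u\<bar>) ^ n / fact n)"
    proof (rule sum_le_suminf)
      show "summable (\<lambda>n. (e * \<bar>ln u\<bar>) ^ n / fact n)"
        using summable_exp_generic[of "e * \<bar>ln u\<bar>"] by (simp add: field_simps)
    qed (use assms in auto)
    also have "\<dots> = exp (e * \<bar>ln u\<bar>)"
      by (simp add: exp_def field_simps)
    finally show ?thesis .
  qed
  also have "exp (e * \<bar>ln u\<bar>) \<le> u powr e + u powr (- e)"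
    using assms by (auto simp: powr_def abs_if)
  finally show ?thesis
    using assms by (simp add: field_simps power_mult_distrib)
qed

lemma integrable_exp_powr_ln:
  fixes p c :: real
  assumes "p > 0" "c > 0"
  shows "integrable lborel_pos (\<lambda>u. exp (- (c * u)) * u powr (p - 1) * \<bar>ln u\<bar> ^ m)"
proof (rule Bochner_Integration.integrable_bound)
  \<comment> \<open>The logarithm is absorbed with \<open>e = p/2\<close>, which keeps both
    \<open>p + p/2\<close> and \<open>p - p/2\<close> positive.\<close>
  let ?g = "\<lambda>u. fact m / (p/2) ^ m * (exp (- (c * u)) * u powr (p + p/2 - 1) + exp (- (c * u)) * u powr (p/2 - 1))"
  show "integrable lborel_pos ?g"
    using assms by (intro integrable_mult_right Bochner_Integration.integrable_add integrable_exp_powr) auto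
  show "(\<lambda>u. exp (- (c * u)) * u powr (p - 1) * \<bar>ln u\<bar> ^ m) \<in> borel_measurable lborel_pos"
    by (intro measurable_restrict_space1) measurable
  have "norm (exp (- (c * u)) * u powr (p - 1) * \<bar>ln u\<bar> ^ m) \<le> norm (?g u)" if "u > 0" for u
  proof -
    have "norm (exp (- (c * u)) * u powr (p - 1) * \<bar>ln u\<bar> ^ m) = exp (- (c * u)) * u powr (p - 1) * \<bar>ln u\<bar> ^ m"
      by (simp add: abs_mult)
    also have "\<dots> \<le>
        exp (- (c * u)) * u powr (p - 1) * (fact m / (p/2) ^ m * (u powr (p/2) + u powr (- (p/2))))"
      using assms that by (intro mult_left_mono abs_ln_power_le) auto
    also have "\<dots> = ?g u"
      using that by (simp add: algebra_simps flip: powr_add)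
    also have "\<dots> \<le> norm (?g u)"
      by (simp only: real_norm_def abs_ge_self)
    finally show ?thesis .
  qed
  then show "AE u in lborel_pos. norm (exp (- (c * u)) * u powr (p - 1) * \<bar>ln u\<bar> ^ m) \<le> norm (?g u)"
    by (intro AE_I2) (simp only: space_lborel_pos)
qed

subsection \<open>The twisted Gamma function\<close>

text \<open>Which of the two powers dominates depends on whether \<open>u >= 1\<close>; their sum
  serves in both cases and gives one majorant for all exponents of a vertical strip.\<close>

lemma powr_le_powr_add_powr:
  fixes u :: real
  assumes "a \<le> r" "r \<le> b"
  shows "u powr r \<le> u powr a + u powr b"
proof (cases "u = 0")
  case False
  have "u powr r \<le> max (u powr a) (u powr b)"
  proof (cases "ln u \<ge> 0")
    case True
    then have "u powr r \<le> u powr b"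
      using assms by (simp add: powr_def mult_right_mono)
    then show ?thesis by simp
  next
    case f: False
    then have "u powr r \<le> u powr a"
      using assms False by (simp add: powr_def mult_right_mono_neg)
    then show ?thesis by simp
  qed
  then show ?thesis by (simp add: max_def split: if_splits) (smt (verit) powr_ge_zero)+
qed simp

text \<open>The integrand of the twisted Gamma function, with a real parameter \<open>c\<close>. The
  exponential in place of \<open>powr\<close> gives holomorphy in \<open>z\<close> and measurability
  in \<open>u\<close> without the side condition \<open>u > 0\<close>.\<close>

definition gamma_kernel :: "real \<Rightarrow> nat \<Rightarrow> complex \<Rightarrow> real \<Rightarrow> complex" where
  "gamma_kernel c m z u =
     of_real (exp (- (c * u))) * exp ((z - 1) * of_real (ln u)) * of_real (ln u ^ m)"

lemma gamma_kernel_altdef: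
  "u > 0 \<Longrightarrow> gamma_kernel c m z u =
     of_real (exp (- (c * u))) * of_real u powr (z - 1) * of_real (ln u ^ m)"
  by (simp add: gamma_kernel_def powr_def Ln_of_real)

lemma gamma_kernel_measurable: "gamma_kernel c m z \<in> borel_measurable lborel_pos"
  unfolding gamma_kernel_def by (intro measurable_restrict_space1) measurable

lemma norm_gamma_kernel:
  "u > 0 \<Longrightarrow> norm (gamma_kernel c m z u) = exp (- (c * u)) * u powr (Re z - 1) * \<bar>ln u\<bar> ^ m"
  by (simp add: gamma_kernel_def norm_mult norm_power powr_def power_abs)

lemma open_strip: "open {z::complex. a < Re z \<and> Re z < b}"
  by (intro open_Collect_conj open_halfspace_Re_gt open_halfspace_Re_lt)

lemma open_right_halfplane: "open (right_halfplane c)"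
  by (rule open_halfspace_Re_gt)

lemma holomorphic_gamma_kernel: "(\<lambda>z. gamma_kernel c m z u) holomorphic_on S"
  unfolding gamma_kernel_def by (intro holomorphic_intros)

lemma norm_gamma_kernel_le:
  assumes "u > 0" "a \<le> Re z" "Re z \<le> b"
  shows "norm (gamma_kernel c m z u) \<le>
    exp (- (c * u)) * u powr (a - 1) * \<bar>ln u\<bar> ^ m + exp (- (c * u)) * u powr (b - 1) * \<bar>ln u\<bar> ^ m"
proof -
  have "u powr (Re z - 1) \<le> u powr (a - 1) + u powr (b - 1)"
    using assms by (intro powr_le_powr_add_powr) auto
  then have "exp (- (c * u)) * u powr (Re z - 1) * \<bar>ln u\<bar> ^ m \<le>
      exp (- (c * u)) * (u powr (a - 1) + u powr (b - 1)) * \<bar>ln u\<bar> ^ m"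
    by (intro mult_left_mono mult_right_mono) auto
  then show ?thesis
    using assms by (simp add: norm_gamma_kernel algebra_simps)
qed

text \<open>Differentiation in \<open>z\<close> brings down a factor \<open>ln u\<close>. The strip
  around \<open>z\<close> stays away from \<open>Re z = 0\<close>, so one majorant serves on all of
  it.\<close>

lemma
  assumes "c > 0" "Re z > 0"
  shows integrable_gamma_kernel: "integrable lborel_pos (gamma_kernel c m z)"
    and has_field_derivative_gamma_integral:
      "((\<lambda>z. \<integral>u. gamma_kernel c m z u \<partial>lborel_pos) has_field_derivative
          (\<integral>u. gamma_kernel c (Suc m) z u \<partial>lborel_pos)) (at z)"
proof -
  define a where "a = Re z / 2"
  define b where "b = Re z + 1"
  define S where "S = {z. a < Re z \<and> Re z < b}"
  have ab: "0 < a" "a < Re z" "Re z < b"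
    using assms by (auto simp: a_def b_def)
  define g where "g = (\<lambda>u. exp (- (c * u)) * u powr (a - 1) * \<bar>ln u\<bar> ^ m +
    exp (- (c * u)) * u powr (b - 1) * \<bar>ln u\<bar> ^ m)"
  have g: "integrable lborel_pos g"
    unfolding g_def using assms ab
    by (intro Bochner_Integration.integrable_add integrable_exp_powr_ln) auto
  have S: "open S" "z \<in> S"
    using ab by (auto simp: S_def open_strip)
  have bound: "norm (gamma_kernel c m w u) \<le> (1 + norm w) ^ 0 * g u"
    if "w \<in> S" "u \<in> space lborel_pos" for w u
    using norm_gamma_kernel_le[of u a w b c m] that
    by (simp add: S_def g_def space_lborel_pos)
  note * = S holomorphic_gamma_kernel gamma_kernel_measurable bound g
  show "integrable lborel_pos (gamma_kernel c m z)"
    by (rule integrable_param[OF *])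
  have "((\<lambda>z. \<integral>u. gamma_kernel c m z u \<partial>lborel_pos) has_field_derivative
          (\<integral>u. deriv (\<lambda>z. gamma_kernel c m z u) z \<partial>lborel_pos)) (at z)"
    by (rule has_field_derivative_integral_param[OF *])
  also have "(\<lambda>u. deriv (\<lambda>z. gamma_kernel c m z u) z) = gamma_kernel c (Suc m) z"
  proof
    fix u
    show "deriv (\<lambda>z. gamma_kernel c m z u) z = gamma_kernel c (Suc m) z u"
      unfolding gamma_kernel_def
      by (rule DERIV_imp_deriv) (auto intro!: derivative_eq_intros simp: algebra_simps)
  qed
  finally show "((\<lambda>z. \<integral>u. gamma_kernel c m z u \<partial>lborel_pos) has_field_derivative
          (\<integral>u. gamma_kernel c (Suc m) z u \<partial>lborel_pos)) (at z)" .
qed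

lemma gamma_integral_bounded_strip:
  assumes "c > 0" "0 < a"
  obtains C where "\<And>z. a \<le> Re z \<Longrightarrow> Re z \<le> b \<Longrightarrow> norm (\<integral>u. gamma_kernel c m z u \<partial>lborel_pos) \<le> C"
proof -
  define g where "g = (\<lambda>u. exp (- (c * u)) * u powr (a - 1) * \<bar>ln u\<bar> ^ m +
    exp (- (c * u)) * u powr (b - 1) * \<bar>ln u\<bar> ^ m)"
  have "norm (\<integral>u. gamma_kernel c m z u \<partial>lborel_pos) \<le> (\<integral>u. g u \<partial>lborel_pos)"
    if "a \<le> Re z" "Re z \<le> b" for z
  proof -
    have "integrable lborel_pos g"
      unfolding g_def using assms that
      by (intro Bochner_Integration.integrable_add integrable_exp_powr_ln) auto
    moreover have "integrable lborel_pos (gamma_kernel c m z)"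
      using assms that by (intro integrable_gamma_kernel) auto
    ultimately show ?thesis
      using norm_gamma_kernel_le[OF _ that, of _ c m]
      by (intro order_trans[OF integral_norm_bound integral_mono])
         (auto simp: space_lborel_pos g_def)
  qed
  then show ?thesis
    by (rule that)
qed

lemma set_lebesgue_integral_pos:
  fixes f :: "real \<Rightarrow> complex"
  shows "(LINT u:{0<..}|lborel. f u) = (\<integral>u. f u \<partial>lborel_pos)"
    and "set_integrable lborel {0<..} f \<longleftrightarrow> integrable lborel_pos f"
  by (simp_all add: set_lebesgue_integral_def set_integrable_def integral_restrict_space integrable_restrict_space)

text \<open>Closed form of the integral for \<open>m = 0\<close>, by substituting
  \<open>u / c\<close> for \<open>u\<close>. Through \<open>Gamma\<close> it makes sense beyond the
  halfplane of convergence, so its derivatives supply the continuation of all twisted Gamma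
  functions.\<close>

definition scaled_Gamma :: "real \<Rightarrow> complex \<Rightarrow> complex" where
  "scaled_Gamma c z = of_real c powr (- z) * Gamma z"

lemma gamma_integral_eq_Gamma:
  assumes "Re z > 0"
  shows "(\<integral>u. gamma_kernel 1 0 z u \<partial>lborel_pos) = Gamma z"
proof -
  have i: "set_integrable lborel {0<..} (gamma_kernel 1 0 z)"
    unfolding set_lebesgue_integral_pos using assms by (intro integrable_gamma_kernel) auto
  have "(\<integral>u. gamma_kernel 1 0 z u \<partial>lborel_pos) = integral {0<..} (gamma_kernel 1 0 z)"
    using set_borel_integral_eq_integral(2)[OF i] by (simp add: set_lebesgue_integral_pos)
  also have "\<dots> = integral {0<..} (\<lambda>t. of_real t powr (z - 1) / of_real (exp t))"
    by (intro integral_cong) (auto simp: gamma_kernel_altdef exp_minus field_simps)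
  also have "\<dots> = Gamma z"
    using Gamma_integral_complex'[OF assms] by (rule integral_unique)
  finally show ?thesis .
qed

lemma gamma_integral_eq_scaled_Gamma:
  assumes "c > 0" "Re z > 0"
  shows "(\<integral>u. gamma_kernel c 0 z u \<partial>lborel_pos) = scaled_Gamma c z"
proof -
  let ?f = "\<lambda>c u. indicat_real {0<..} u *\<^sub>R gamma_kernel c 0 z u"
  have eq: "?f c (0 + inverse c * u) = of_real c powr (1 - z) * ?f 1 u" for u
  proof (cases "u > 0")
    case True
    then have "ln (inverse c * u) = ln u - ln c"
      using assms by (simp add: ln_mult ln_inverse)
    then have "exp ((z - 1) * of_real (ln (inverse c * u))) =
        of_real c powr (1 - z) * exp ((z - 1) * of_real (ln u))"
      using assms by (simp del: ln_inverse add: powr_def Ln_of_real exp_add [symmetric]) (simp add: algebra_simps)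
    then show ?thesis
      using True assms by (simp add: gamma_kernel_def)
  next
    case False
    then have "\<not> 0 < inverse c * u"
      using assms by (simp add: zero_less_mult_iff)
    then show ?thesis
      using False by simp
  qed
  have "(\<integral>u. gamma_kernel c 0 z u \<partial>lborel_pos) = (\<integral>u. ?f c u \<partial>lborel)"
    by (simp add: integral_restrict_space)
  also have "\<dots> = \<bar>inverse c\<bar> *\<^sub>R (\<integral>u. ?f c (0 + inverse c * u) \<partial>lborel)"
    using assms by (intro lborel_integral_real_affine) auto
  also have "\<dots> = of_real (inverse c) * (of_real c powr (1 - z) * (\<integral>u. ?f 1 u \<partial>lborel))"
    unfolding eq using assms by (simp add: scaleR_conv_of_real)
  also have "(\<integral>u. ?f 1 u \<partial>lborel) = Gamma z"
    using gamma_integral_eq_Gamma[OF assms(2)] by (simp add: integral_restrict_space)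
  also have "of_real (inverse c) * (of_real c powr (1 - z) * Gamma z) = scaled_Gamma c z"
    using assms by (simp add: scaled_Gamma_def powr_diff powr_minus field_simps)
  finally show ?thesis .
qed

lemma higher_deriv_scaled_Gamma:
  assumes "c > 0" "Re z > 0"
  shows "(deriv ^^ m) (scaled_Gamma c) z = (\<integral>u. gamma_kernel c m z u \<partial>lborel_pos)"
  using assms(2)
proof (induction m arbitrary: z)
  case 0
  then show ?case
    using assms(1) by (simp add: gamma_integral_eq_scaled_Gamma)
next
  case (Suc m)
  have "((deriv ^^ m) (scaled_Gamma c) has_field_derivative
      (\<integral>u. gamma_kernel c (Suc m) z u \<partial>lborel_pos)) (at z)"
  proof (rule has_field_derivative_transform_within_open)
    show "((\<lambda>z. \<integral>u. gamma_kernel c m z u \<partial>lborel_pos) has_field_derivative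
        (\<integral>u. gamma_kernel c (Suc m) z u \<partial>lborel_pos)) (at z)"
      using assms(1) Suc.prems by (rule has_field_derivative_gamma_integral)
    show "open (right_halfplane 0)"
      by (rule open_right_halfplane)
  qed (use Suc in auto)
  then show ?case
    by (simp add: DERIV_imp_deriv)
qed

lemma holomorphic_scaled_Gamma:
  assumes "c > 0"
  shows "scaled_Gamma c holomorphic_on (- \<int>\<^sub>\<le>\<^sub>0)"
  unfolding scaled_Gamma_def [abs_def] using assms by (intro holomorphic_intros) auto

lemma meromorphic_scaled_Gamma:
  assumes "c > 0"
  shows "scaled_Gamma c meromorphic_on A"
proof -
  \<comment> \<open>Inverting the entire function \<open>rGamma\<close> gives meromorphy at once; by
    \<open>inverse 0 = 0\<close> the expression agrees with \<open>scaled_Gamma\<close> even at the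
    poles.\<close>
  have "(\<lambda>z. exp (- z * of_real (ln c)) * inverse (rGamma z)) meromorphic_on A"
  proof (intro meromorphic_intros analytic_on_imp_meromorphic_on)
    show "(\<lambda>z. exp (- z * complex_of_real (ln c))) analytic_on A"
      by (intro analytic_intros)
    show "rGamma analytic_on A"
      using holomorphic_rGamma analytic_on_holomorphic by blast
  qed
  also have "(\<lambda>z. exp (- z * of_real (ln c)) * inverse (rGamma z)) = scaled_Gamma c"
    using assms by (simp add: fun_eq_iff scaled_Gamma_def powr_def Ln_of_real Gamma_def)
  finally show ?thesis .
qed

lemma not_nonpos_Int_of_Re: "Re z > 0 \<Longrightarrow> z \<notin> \<int>\<^sub>\<le>\<^sub>0"
  by (auto elim!: nonpos_Ints_cases)

lemma is_twisted_Gamma_higher_deriv: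
  assumes "l \<ge> 1"
  shows "is_twisted_Gamma l m ((deriv ^^ m) (scaled_Gamma (real l)))"
  unfolding is_twisted_Gamma_def
proof (intro conjI allI impI)
  have l: "real l > 0" using assms by simp
  show "(deriv ^^ m) (scaled_Gamma (real l)) meromorphic_on UNIV"
    by (intro meromorphic_on_higher_deriv meromorphic_scaled_Gamma l)
  show "(deriv ^^ m) (scaled_Gamma (real l)) holomorphic_on - \<int>\<^sub>\<le>\<^sub>0"
    by (intro holomorphic_higher_deriv holomorphic_scaled_Gamma l) (simp add: open_Compl)
  fix s :: complex assume s: "Re s > 0"
  let ?k = "\<lambda>u. of_real (exp (- (real l * u))) * of_real u powr (s - 1) * of_real (ln u ^ m)"
  have eq: "integrable lborel_pos ?k = integrable lborel_pos (gamma_kernel (real l) m s)"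
    by (intro Bochner_Integration.integrable_cong refl)
       (simp add: gamma_kernel_altdef space_lborel_pos)
  show "set_integrable lborel {0<..} ?k"
    unfolding set_lebesgue_integral_pos eq using l s by (rule integrable_gamma_kernel)
  have "(deriv ^^ m) (scaled_Gamma (real l)) s = (\<integral>u. gamma_kernel (real l) m s u \<partial>lborel_pos)"
    using l s by (rule higher_deriv_scaled_Gamma)
  also have "\<dots> = (\<integral>u. ?k u \<partial>lborel_pos)"
    by (intro Bochner_Integration.integral_cong refl)
       (simp add: gamma_kernel_altdef space_lborel_pos)
  finally show "(deriv ^^ m) (scaled_Gamma (real l)) s = (LINT u:{0<..}|lborel. ?k u)"
    by (simp only: set_lebesgue_integral_pos)
qed

text \<open>The chosen function is known only by its integral on the right and by holomorphy off the
  nonpositive integers. Removing a countable set leaves the plane connected, so the identity theorem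
  settles the rest.\<close>

lemma twisted_Gamma_eq:
  assumes "l \<ge> 1" "z \<notin> \<int>\<^sub>\<le>\<^sub>0"
  shows "twisted_Gamma l m z = (deriv ^^ m) (scaled_Gamma (real l)) z"
proof (rule analytic_continuation_open[where s = "right_halfplane 0" and s' = "- \<int>\<^sub>\<le>\<^sub>0"
      and f = "twisted_Gamma l m" and g = "(deriv ^^ m) (scaled_Gamma (real l))"])
  have 1: "is_twisted_Gamma l m (twisted_Gamma l m)"
    unfolding twisted_Gamma_def
    by (rule someI[of "is_twisted_Gamma l m", OF is_twisted_Gamma_higher_deriv[OF assms(1)]])
  have 2: "is_twisted_Gamma l m ((deriv ^^ m) (scaled_Gamma (real l)))"
    by (rule is_twisted_Gamma_higher_deriv[OF assms(1)])
  show "twisted_Gamma l m holomorphic_on - \<int>\<^sub>\<le>\<^sub>0"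
    "(deriv ^^ m) (scaled_Gamma (real l)) holomorphic_on - \<int>\<^sub>\<le>\<^sub>0"
    using 1 2 by (auto simp: is_twisted_Gamma_def)
  show "twisted_Gamma l m w = (deriv ^^ m) (scaled_Gamma (real l)) w" if "w \<in> right_halfplane 0" for w
    using 1 2 that by (simp add: is_twisted_Gamma_def)
  show "open (right_halfplane 0)"
    by (rule open_right_halfplane)
  show "right_halfplane 0 \<noteq> {}"
    using one_complex.sel(1) zero_less_one by (metis (mono_tags) empty_iff mem_Collect_eq)
  show "right_halfplane 0 \<subseteq> - \<int>\<^sub>\<le>\<^sub>0"
    using not_nonpos_Int_of_Re by auto
  have "connected (UNIV - \<int>\<^sub>\<le>\<^sub>0 :: complex set)"
    by (intro connected_open_diff_countable) (auto intro: countable_subset[OF nonpos_Ints_subset_Ints] countable_int)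
  then show "connected (- \<int>\<^sub>\<le>\<^sub>0 :: complex set)"
    by (simp add: Compl_eq_Diff_UNIV)
qed (use assms in \<open>auto simp: open_Compl\<close>)

lemma higher_deriv_exp_linear:
  "(deriv ^^ n) (\<lambda>z. exp (a * z)) = (\<lambda>z::complex. a ^ n * exp (a * z))"
proof (induction n)
  case (Suc n)
  have "deriv (\<lambda>z. a ^ n * exp (a * z)) z = a ^ Suc n * exp (a * z)" for z
    by (rule DERIV_imp_deriv) (auto intro!: derivative_eq_intros)
  then show ?case
    using Suc by auto
qed auto

text \<open>\<open>c powr (- z)\<close> is the product of \<open>scaled_Gamma c z\<close> and
  \<open>rGamma z\<close>. Its \<open>b\<close>-th derivative at \<open>w\<close> carries
  \<open>(- ln c) ^ b\<close>, whence the sign; the Leibniz rule gives the sum.\<close>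

lemma powr_ln_power_eq_gamma_integrals:
  fixes c w :: real
  assumes "c > 0" "w > 0"
  shows "of_real (c powr (- w) * ln c ^ b) =
    (-1) ^ b * (\<Sum>m\<le>b. of_nat (b choose m) * (deriv ^^ (b - m)) rGamma (of_real w) *
       (\<integral>u. gamma_kernel c m (of_real w) u \<partial>lborel_pos))"
proof -
  let ?S = "right_halfplane 0"
  have w: "of_real w \<in> ?S"
    using assms by simp
  have hol: "scaled_Gamma c holomorphic_on ?S"
    by (rule holomorphic_on_subset[OF holomorphic_scaled_Gamma[OF assms(1)]])
       (use not_nonpos_Int_of_Re in auto)
  have "(- of_real (ln c)) ^ b * exp (- of_real (ln c) * complex_of_real w) =
      (deriv ^^ b) (\<lambda>z. exp (- of_real (ln c) * z)) (of_real w)"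
    by (simp only: higher_deriv_exp_linear)
  also have "\<dots> = (deriv ^^ b) (\<lambda>z. scaled_Gamma c z * rGamma z) (of_real w)"
  proof (rule higher_deriv_transform_within_open[OF _ _ open_right_halfplane w])
    fix z assume "z \<in> ?S"
    then have "Gamma z * rGamma z = 1"
      using not_nonpos_Int_of_Re[of z] by (simp add: Gamma_def rGamma_eq_zero_iff)
    then show "exp (- of_real (ln c) * z) = scaled_Gamma c z * rGamma z"
      using assms by (simp add: scaled_Gamma_def powr_def Ln_of_real algebra_simps)
  qed (intro holomorphic_intros hol holomorphic_rGamma)+
  also have "\<dots> = (\<Sum>m=0..b. of_nat (b choose m) * (deriv ^^ m) (scaled_Gamma c) (of_real w) *
      (deriv ^^ (b - m)) rGamma (of_real w))"
    by (rule higher_deriv_mult[OF hol holomorphic_rGamma open_right_halfplane w])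
  also have "\<dots> = (\<Sum>m\<le>b. of_nat (b choose m) * (deriv ^^ (b - m)) rGamma (of_real w) *
       (\<integral>u. gamma_kernel c m (of_real w) u \<partial>lborel_pos))"
    using assms by (intro sum.cong) (auto simp: higher_deriv_scaled_Gamma)
  finally have eq: "(- of_real (ln c)) ^ b * exp (- of_real (ln c) * complex_of_real w) = \<dots>" .
  have "c powr (- w) * ln c ^ b = (-1) ^ b * ((- ln c) ^ b * exp (- ln c * w))"
    using assms by (simp add: powr_def mult_ac flip: power_mult_distrib mult.assoc)
  then have "of_real (c powr (- w) * ln c ^ b) =
      (-1) ^ b * ((- of_real (ln c)) ^ b * exp (- of_real (ln c) * complex_of_real w))"
    by (simp only: of_real_mult of_real_minus of_real_power of_real_exp of_real_1)
  then show ?thesis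
    unfolding eq .
qed

subsection \<open>Polynomial growth and the pole of the twisted Gamma function\<close>

text \<open>An explicit inequality on all of \<open>S\<close> instead of an asymptotic one: it is
  stable under finite sums and products without any filters, and it implies both notions of
  polynomial growth.\<close>

definition polybdd :: "(complex \<Rightarrow> complex) \<Rightarrow> complex set \<Rightarrow> bool" where
  "polybdd f S \<longleftrightarrow> (\<exists>C N. \<forall>s\<in>S. norm (f s) \<le> C * (1 + norm s) ^ N)"

lemma polybddI: "(\<And>s. s \<in> S \<Longrightarrow> norm (f s) \<le> C * (1 + norm s) ^ N) \<Longrightarrow> polybdd f S"
  unfolding polybdd_def by blast

lemma polybdd_bounded: "(\<And>s. s \<in> S \<Longrightarrow> norm (f s) \<le> C) \<Longrightarrow> polybdd f S"
  by (rule polybddI[of S f C 0]) simp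

lemma polybdd_const: "polybdd (\<lambda>_. c) S"
  by (rule polybdd_bounded) (rule order_refl)

lemma polybdd_id: "polybdd (\<lambda>s. s) S"
  by (rule polybddI[of _ _ 1 1]) simp

lemma polybdd_subset: "polybdd f T \<Longrightarrow> S \<subseteq> T \<Longrightarrow> polybdd f S"
  unfolding polybdd_def by blast

lemma polybdd_cong: "(\<And>s. s \<in> S \<Longrightarrow> f s = g s) \<Longrightarrow> polybdd f S \<longleftrightarrow> polybdd g S"
  unfolding polybdd_def by simp

lemma polybddE:
  assumes "polybdd f S"
  obtains C N where "C \<ge> 0" "\<And>s. s \<in> S \<Longrightarrow> norm (f s) \<le> C * (1 + norm s) ^ N"
proof -
  obtain C N where C: "\<And>s. s \<in> S \<Longrightarrow> norm (f s) \<le> C * (1 + norm s) ^ N"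
    using assms unfolding polybdd_def by blast
  have "norm (f s) \<le> \<bar>C\<bar> * (1 + norm s) ^ N" if "s \<in> S" for s
    using C[OF that] by (rule order_trans) (intro mult_right_mono, auto)
  then show ?thesis
    using that[of "\<bar>C\<bar>" N] by simp
qed

lemma polybdd_mult:
  assumes "polybdd f S" "polybdd g S"
  shows "polybdd (\<lambda>s. f s * g s) S"
proof -
  obtain C N where f: "C \<ge> 0" "\<And>s. s \<in> S \<Longrightarrow> norm (f s) \<le> C * (1 + norm s) ^ N"
    using polybddE[OF assms(1)] by blast
  obtain D M where g: "D \<ge> 0" "\<And>s. s \<in> S \<Longrightarrow> norm (g s) \<le> D * (1 + norm s) ^ M"
    using polybddE[OF assms(2)] by blast
  show ?thesis
  proof (rule polybddI[of _ _ "C * D" "N + M"])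
    fix s assume "s \<in> S"
    then have "norm (f s) * norm (g s) \<le> (C * (1 + norm s) ^ N) * (D * (1 + norm s) ^ M)"
      using f g by (intro mult_mono) auto
    then show "norm (f s * g s) \<le> C * D * (1 + norm s) ^ (N + M)"
      by (simp add: norm_mult power_add mult_ac)
  qed
qed

lemma polybdd_add:
  assumes "polybdd f S" "polybdd g S"
  shows "polybdd (\<lambda>s. f s + g s) S"
proof -
  obtain C N where f: "C \<ge> 0" "\<And>s. s \<in> S \<Longrightarrow> norm (f s) \<le> C * (1 + norm s) ^ N"
    using polybddE[OF assms(1)] by blast
  obtain D M where g: "D \<ge> 0" "\<And>s. s \<in> S \<Longrightarrow> norm (g s) \<le> D * (1 + norm s) ^ M"
    using polybddE[OF assms(2)] by blast
  show ?thesis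
  proof (rule polybddI[of _ _ "C + D" "N + M"])
    fix s assume s: "s \<in> S"
    have "norm (f s + g s) \<le> C * (1 + norm s) ^ N + D * (1 + norm s) ^ M"
      using f(2)[OF s] g(2)[OF s] norm_triangle_ineq[of "f s" "g s"] by linarith
    also have "\<dots> \<le> C * (1 + norm s) ^ (N + M) + D * (1 + norm s) ^ (N + M)"
      using f(1) g(1) by (intro add_mono mult_left_mono power_increasing) auto
    finally show "norm (f s + g s) \<le> (C + D) * (1 + norm s) ^ (N + M)"
      by (simp add: algebra_simps)
  qed
qed

lemma polybdd_diff: "polybdd f S \<Longrightarrow> polybdd g S \<Longrightarrow> polybdd (\<lambda>s. f s - g s) S"
  using polybdd_add[OF _ polybdd_mult[OF polybdd_const[of "-1"]], of f S g] by simp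

lemma polybdd_sum: "(\<And>i. i \<in> I \<Longrightarrow> polybdd (f i) S) \<Longrightarrow> polybdd (\<lambda>s. \<Sum>i\<in>I. f i s) S"
  by (induction I rule: infinite_finite_induct) (auto intro!: polybdd_const polybdd_add)

lemma polybdd_prod: "(\<And>i. i \<in> I \<Longrightarrow> polybdd (f i) S) \<Longrightarrow> polybdd (\<lambda>s. \<Prod>i\<in>I. f i s) S"
  by (induction I rule: infinite_finite_induct) (auto intro!: polybdd_const polybdd_mult)

lemma polybdd_power: "polybdd f S \<Longrightarrow> polybdd (\<lambda>s. f s ^ n) S"
  by (induction n) (auto intro!: polybdd_const polybdd_mult)

lemma polybdd_extend:
  assumes "polybdd f S"
  shows "polybdd (\<lambda>s. if s \<in> S then f s else 0) T"
proof -
  obtain C N where f: "C \<ge> 0" "\<And>s. s \<in> S \<Longrightarrow> norm (f s) \<le> C * (1 + norm s) ^ N"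
    using polybddE[OF assms] by blast
  then show ?thesis
    by (intro polybddI[of _ _ C N]) auto
qed

lemma polybdd_Un:
  assumes "polybdd f S" "polybdd f T"
  shows "polybdd f (S \<union> T)"
proof -
  have "polybdd f (T - S)"
    using assms(2) by (rule polybdd_subset) auto
  then have "polybdd (\<lambda>s. (if s \<in> S then f s else 0) + (if s \<in> T - S then f s else 0)) (S \<union> T)"
    using assms(1) by (intro polybdd_add polybdd_extend)
  then show ?thesis
    by (rule polybdd_cong[THEN iffD1, rotated]) auto
qed

lemma norm_powr_bound:
  fixes s :: complex
  assumes "norm s \<ge> 1" "C \<ge> 0"
  shows "C * (1 + norm s) ^ N \<le> C * 2 ^ N * norm (complex_of_real (norm s powr real N))"
proof -
  have "(1 + norm s) ^ N \<le> (2 * norm s) ^ N"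
    using assms by (intro power_mono) auto
  also have "\<dots> = 2 ^ N * norm s powr real N"
    using powr_realpow[of "norm s" N] assms by (simp only: power_mult_distrib)
  finally show ?thesis
    using assms by (simp add: mult_left_mono mult.assoc)
qed

lemma poly_growth_on_if_polybdd:
  assumes "polybdd f S"
  shows "poly_growth_on f S"
proof -
  obtain C N where f: "C \<ge> 0" "\<And>s. s \<in> S \<Longrightarrow> norm (f s) \<le> C * (1 + norm s) ^ N"
    using polybddE[OF assms] by blast
  have "f \<in> O[inf at_infinity (principal S)](\<lambda>s. of_real (norm s powr real N))"
  proof (rule bigoI)
    have "eventually (\<lambda>s::complex. norm s \<ge> 1) at_infinity"
      by (auto simp: eventually_at_infinity)
    then show "eventually (\<lambda>s. norm (f s) \<le> C * 2 ^ N * norm (complex_of_real (norm s powr real N)))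
        (inf at_infinity (principal S))"
      unfolding eventually_inf_principal
    proof eventually_elim
      case (elim s)
      then show ?case
        using f norm_powr_bound order_trans by blast
    qed
  qed
  then show ?thesis
    unfolding poly_growth_on_def by blast
qed

text \<open>Only large heights matter in the limit, so the neighbourhood of a pole on the real axis
  may be left out.\<close>

lemma poly_growth_Im_on_if_polybdd:
  assumes "polybdd f (S \<inter> {s. \<bar>Im s\<bar> \<ge> 1})"
  shows "poly_growth_Im_on f S"
proof -
  obtain C N where f: "C \<ge> 0" "\<And>s. s \<in> S \<inter> {s. \<bar>Im s\<bar> \<ge> 1} \<Longrightarrow> norm (f s) \<le> C * (1 + norm s) ^ N"
    using polybddE[OF assms] by blast
  have "f \<in> O[inf (filtercomap (\<lambda>s. \<bar>Im s\<bar>) at_top) (principal S)](\<lambda>s. of_real (norm s powr real N))"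
  proof (rule bigoI)
    have "eventually (\<lambda>s::complex. \<bar>Im s\<bar> \<ge> 1) (filtercomap (\<lambda>s. \<bar>Im s\<bar>) at_top)"
      using eventually_ge_at_top by (rule eventually_filtercomapI)
    then show "eventually (\<lambda>s. norm (f s) \<le> C * 2 ^ N * norm (complex_of_real (norm s powr real N)))
        (inf (filtercomap (\<lambda>s. \<bar>Im s\<bar>) at_top) (principal S))"
      unfolding eventually_inf_principal
    proof eventually_elim
      case (elim s)
      have "norm s \<ge> 1"
        using elim abs_Im_le_cmod order_trans by blast
      then show ?case
        using elim f norm_powr_bound order_trans by blast
    qed
  qed
  then show ?thesis
    unfolding poly_growth_Im_on_def by blast
qed

lemma polybdd_falling: "polybdd (\<lambda>s. falling s k) S"
  unfolding falling_def by (intro polybdd_prod polybdd_diff polybdd_id polybdd_const)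

lemma holomorphic_falling: "(\<lambda>s. falling s k) holomorphic_on S"
  unfolding falling_def by (intro holomorphic_intros)

section \<open>The regular part of the Gamma function at 0\<close>

text \<open>Here \<open>scaled_Gamma c z = g z / z\<close> and \<open>g 0 = 1\<close>, so the
  difference quotient of \<open>g\<close> at 0 is what remains after removing the polar part
  \<open>1 / z\<close>. The value at 0 fills the removable singularity.\<close>

definition Gamma_reg :: "real \<Rightarrow> complex \<Rightarrow> complex" where
  "Gamma_reg c z =
     (let g = \<lambda>z. of_real c powr (- z) * Gamma (z + 1)
      in if z = 0 then deriv g 0 else (g z - g 0) / (z - 0))"

lemma Gamma_reg:
  assumes "c \<ge> 1"
  shows holomorphic_Gamma_reg: "Gamma_reg c holomorphic_on right_halfplane (-1)"
    and scaled_Gamma_eq_Gamma_reg: "z \<notin> \<int>\<^sub>\<le>\<^sub>0 \<Longrightarrow> scaled_Gamma c z = 1 / z + Gamma_reg c z"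
proof -
  show "Gamma_reg c holomorphic_on right_halfplane (-1)"
    unfolding Gamma_reg_def [abs_def] Let_def
  proof (rule pole_lemma_open)
    have "z + 1 \<notin> \<int>\<^sub>\<le>\<^sub>0" if "Re z > -1" for z
      using that by (intro not_nonpos_Int_of_Re) auto
    then show "(\<lambda>z. of_real c powr (- z) * Gamma (z + 1)) holomorphic_on right_halfplane (-1)"
      using assms by (intro holomorphic_intros) auto
  qed (rule open_right_halfplane)
  show "scaled_Gamma c z = 1 / z + Gamma_reg c z" if "z \<notin> \<int>\<^sub>\<le>\<^sub>0"
  proof -
    have "z \<noteq> 0" using that by auto
    then show ?thesis
      using assms Gamma_plus1[OF that] by (simp add: scaled_Gamma_def Gamma_reg_def field_simps)
  qed
qed

text \<open>Near 0 compactness suffices. Elsewhere \<open>1 / norm z\<close> is at most 4, and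
  \<open>Gamma (z + 1)\<close> is bounded by its convergent integral, since
  \<open>Re (z + 1) >= 1/2\<close>.\<close>

lemma bounded_Gamma_reg:
  assumes "c \<ge> 1"
  obtains C where "C > 0" "\<And>z. -1/2 \<le> Re z \<Longrightarrow> Re z \<le> x \<Longrightarrow> norm (Gamma_reg c z) \<le> C"
proof -
  have "cball 0 (1/4) \<subseteq> right_halfplane (-1)"
  proof
    fix z :: complex assume "z \<in> cball 0 (1/4)"
    then show "z \<in> right_halfplane (-1)"
      using abs_Re_le_cmod[of z] by simp
  qed
  then have "continuous_on (cball 0 (1/4)) (Gamma_reg c)"
    using holomorphic_Gamma_reg[OF assms] holomorphic_on_imp_continuous_on holomorphic_on_subset by blast
  then have "bounded (Gamma_reg c ` cball 0 (1/4))"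
    by (intro compact_imp_bounded compact_continuous_image) auto
  then obtain C1 where C1: "\<forall>w\<in>Gamma_reg c ` cball 0 (1/4). norm w \<le> C1"
    unfolding bounded_iff by blast
  obtain C2 where C2: "\<And>z. 1/2 \<le> Re z \<Longrightarrow> Re z \<le> x + 1 \<Longrightarrow>
      norm (\<integral>u. gamma_kernel 1 0 z u \<partial>lborel_pos) \<le> C2"
    using gamma_integral_bounded_strip[of 1 "1/2" "x + 1" 0] by auto
  have g: "norm (of_real c powr (- z) * Gamma (z + 1)) \<le> c powr (1/2) * C2"
    if "-1/2 \<le> Re z" "Re z \<le> x" for z
  proof -
    have "norm (Gamma (z + 1)) \<le> C2"
      using C2[of "z + 1"] gamma_integral_eq_Gamma[of "z + 1"] that by simp
    moreover have "norm (of_real c powr (- z)) \<le> c powr (1/2)"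
      using assms that by (simp add: norm_powr_real_powr powr_mono)
    ultimately show ?thesis
      unfolding norm_mult by (intro mult_mono) auto
  qed
  define C where "C = max 1 (max C1 (4 * (c powr (1/2) * C2 + 1)))"
  show thesis
  proof (rule that)
    show "C > 0" by (simp add: C_def)
    fix z :: complex assume z: "-1/2 \<le> Re z" "Re z \<le> x"
    show "norm (Gamma_reg c z) \<le> C"
    proof (cases "norm z \<le> 1/4")
      case True
      then have "norm (Gamma_reg c z) \<le> C1"
        using C1 by auto
      then show ?thesis
        by (simp add: C_def)
    next
      case False
      have "norm (of_real c powr (- z) * Gamma (z + 1) - 1) \<le> c powr (1/2) * C2 + 1"
        using g[OF z] norm_triangle_ineq4[of "of_real c powr (- z) * Gamma (z + 1)" 1] by simp
      then have "norm (of_real c powr (- z) * Gamma (z + 1) - 1) / norm z \<le> (c powr (1/2) * C2 + 1) / (1/4)"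
        using False order_trans[OF norm_ge_zero] by (intro frac_le) auto
      moreover have "z \<noteq> 0" using False by auto
      ultimately have "norm (Gamma_reg c z) \<le> 4 * (c powr (1/2) * C2 + 1)"
        using assms by (simp add: Gamma_reg_def norm_divide)
      then show ?thesis by (auto simp: C_def)
    qed
  qed
qed

text \<open>Cauchy's inequality on circles of radius 1/4, for which the bound on
  \<open>Gamma_reg\<close> must be available on a wider strip, down to -1/2. The edge -1/4 reached
  here is the width of the continuation in the theorem.\<close>

lemma bounded_higher_deriv_Gamma_reg:
  assumes "c \<ge> 1"
  obtains C where "\<And>z. -1/4 \<le> Re z \<Longrightarrow> Re z \<le> x \<Longrightarrow> norm ((deriv ^^ m) (Gamma_reg c) z) \<le> C"
proof -
  obtain C where C: "C > 0" "\<And>z. -1/2 \<le> Re z \<Longrightarrow> Re z \<le> x + 1 \<Longrightarrow> norm (Gamma_reg c z) \<le> C"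
    using bounded_Gamma_reg[OF assms, of "x + 1"] by blast
  have "norm ((deriv ^^ m) (Gamma_reg c) z) \<le> fact m * C / (1/4) ^ m"
    if z: "-1/4 \<le> Re z" "Re z \<le> x" for z
  proof (rule Cauchy_inequality)
    have near: "-1/2 \<le> Re w \<and> Re w \<le> x + 1" if "norm (z - w) \<le> 1/4" for w
      using abs_Re_le_cmod[of "z - w"] z that by (auto simp: abs_le_iff)
    then have sub: "cball z (1/4) \<subseteq> right_halfplane (-1)"
      by (force simp: dist_norm)
    show "Gamma_reg c holomorphic_on ball z (1/4)"
      using holomorphic_on_subset[OF holomorphic_Gamma_reg[OF assms]] sub ball_subset_cball by blast
    show "continuous_on (cball z (1/4)) (Gamma_reg c)"
      using holomorphic_Gamma_reg[OF assms] sub holomorphic_on_imp_continuous_on holomorphic_on_subset by blast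
    show "norm (Gamma_reg c w) \<le> C" if "norm (z - w) = 1/4" for w
      using near[of w] C(2) that by simp
  qed simp
  then show ?thesis
    by (rule that)
qed

lemma higher_deriv_inverse_id:
  "z \<noteq> 0 \<Longrightarrow> (deriv ^^ m) (\<lambda>z. 1 / z) z = (-1) ^ m * fact m / (z::complex) ^ Suc m"
proof (induction m arbitrary: z)
  case (Suc m)
  have "((deriv ^^ m) (\<lambda>z. 1 / z) has_field_derivative (-1) ^ Suc m * fact (Suc m) / z ^ Suc (Suc m)) (at z)"
  proof (rule has_field_derivative_transform_within_open)
    have "((\<lambda>z::complex. (-1) ^ m * fact m * inverse z ^ Suc m) has_field_derivative
        (-1) ^ m * fact m * (of_nat (Suc m) * (- (inverse z * inverse z) * inverse z ^ m))) (at z)"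
      using DERIV_cmult[OF DERIV_power[OF DERIV_inverse[OF Suc.prems], of "Suc m"], of "(-1) ^ m * fact m"]
      by (simp add: power2_eq_square numeral_2_eq_2)
    then show "((\<lambda>z::complex. (-1) ^ m * fact m / z ^ Suc m) has_field_derivative
        (-1) ^ Suc m * fact (Suc m) / z ^ Suc (Suc m)) (at z)"
      by (simp add: divide_inverse power_inverse mult_ac)
    show "open (- {0::complex})" by (rule open_Compl) simp
  qed (use Suc in auto)
  then show ?case
    by (simp add: DERIV_imp_deriv)
qed simp

lemma higher_deriv_scaled_Gamma_reg:
  assumes "c \<ge> 1" "Re z > -1" "z \<noteq> 0"
  shows "(deriv ^^ m) (scaled_Gamma c) z =
    (-1) ^ m * fact m / z ^ Suc m + (deriv ^^ m) (Gamma_reg c) z"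
proof -
  let ?S = "right_halfplane (-1) - {0}"
  have S: "open ?S" "z \<in> ?S"
    using assms open_right_halfplane[of "-1"] by auto
  have nonpos: "w \<notin> \<int>\<^sub>\<le>\<^sub>0" if "w \<in> ?S" for w
    using that by (auto elim!: nonpos_Ints_cases)
  have hol: "(\<lambda>z. 1 / z) holomorphic_on ?S" "Gamma_reg c holomorphic_on ?S"
    using holomorphic_on_subset[OF holomorphic_Gamma_reg[OF assms(1)]]
    by (auto intro!: holomorphic_intros)
  have "?S \<subseteq> - \<int>\<^sub>\<le>\<^sub>0"
    using nonpos by blast
  then have "scaled_Gamma c holomorphic_on ?S"
    using assms(1) by (intro holomorphic_on_subset[OF holomorphic_scaled_Gamma]) auto
  note hol = hol this
  have "(deriv ^^ m) (scaled_Gamma c) z = (deriv ^^ m) (\<lambda>z. 1 / z + Gamma_reg c z) z"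
    using hol scaled_Gamma_eq_Gamma_reg[OF assms(1) nonpos]
    by (intro higher_deriv_transform_within_open[OF _ _ S] holomorphic_on_add) auto
  also have "\<dots> = (deriv ^^ m) (\<lambda>z. 1 / z) z + (deriv ^^ m) (Gamma_reg c) z"
    by (rule higher_deriv_add[OF hol(1,2) S])
  finally show ?thesis
    by (simp only: higher_deriv_inverse_id[OF assms(3)])
qed

subsection \<open>The integrals behind the Newton series\<close>

lemma holomorphic_integral_polybdd:
  fixes f :: "complex \<Rightarrow> 'a \<Rightarrow> complex"
  assumes "open S"
    and "\<And>x. x \<in> space M \<Longrightarrow> (\<lambda>z. f z x) holomorphic_on S"
    and "\<And>z. z \<in> S \<Longrightarrow> f z \<in> borel_measurable M"
    and "\<And>z x. z \<in> S \<Longrightarrow> x \<in> space M \<Longrightarrow> norm (f z x) \<le> (1 + norm z) ^ N * g x"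
    and "integrable M g"
  shows "(\<lambda>z. \<integral>x. f z x \<partial>M) holomorphic_on S" "polybdd (\<lambda>z. \<integral>x. f z x \<partial>M) S"
proof -
  show "(\<lambda>z. \<integral>x. f z x \<partial>M) holomorphic_on S"
    using has_field_derivative_integral_param[OF assms(1) _ assms(2-5)] holomorphic_on_open[OF assms(1)]
    by blast
  show "polybdd (\<lambda>z. \<integral>x. f z x \<partial>M) S"
    using norm_integral_param_le[OF assms(1) _ assms(2-5)]
    by (intro polybddI[of _ _ "\<integral>x. g x \<partial>M" N]) (simp add: mult.commute)
qed

text \<open>Follows from \<open>1 + x <= exp x\<close> at \<open>x = u / K\<close>. With
  \<open>K = 2 * q + 2\<close> one has \<open>q / K <= 1/2\<close>, so the price
  \<open>exp (u / 2)\<close> is still covered by \<open>exp (- i * u)\<close> for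
  \<open>i >= 1\<close>.\<close>

lemma one_plus_powr_le_exp:
  fixes u q :: real
  assumes "u > 0" "q \<ge> 0"
  shows "(1 + u) powr q \<le> (2 * q + 2) powr q * exp (u / 2)"
proof -
  define K where "K = 2 * q + 2"
  have K: "K \<ge> 1" "q / K \<le> 1 / 2" "K > 0"
    using assms by (auto simp: K_def field_simps)
  have "1 + u \<le> K * (1 + u / K)"
    using K by (simp add: field_simps)
  also have "\<dots> \<le> K * exp (u / K)"
    using K by (intro mult_left_mono exp_ge_add_one_self) auto
  finally have "(1 + u) powr q \<le> (K * exp (u / K)) powr q"
    using assms by (intro powr_mono2) auto
  also have "\<dots> = K powr q * exp (q / K * u)"
    using K by (simp add: powr_def ln_mult exp_add ring_distribs)
  also have "\<dots> \<le> K powr q * exp (1 / 2 * u)"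
    using assms mult_right_mono[OF K(2), of u] by (intro mult_left_mono iffD2[OF exp_le_cancel_iff]) auto
  finally show ?thesis
    by (simp add: K_def)
qed

text \<open>The last estimate measures how well \<open>u\<close> approximates
  \<open>1 - exp (- u)\<close> at 0; its quadratic order is what makes the remainder converge
  further to the left.\<close>

lemma one_minus_exp_bounds:
  fixes u :: real
  assumes "u > 0"
  shows "1 - exp (- u) > 0" "1 - exp (- u) < 1" "1 - exp (- u) \<le> u"
    "u / (1 + u) \<le> 1 - exp (- u)" "u - (1 - exp (- u)) \<le> u\<^sup>2"
proof -
  show "1 - exp (- u) > 0" "1 - exp (- u) < 1" "1 - exp (- u) \<le> u"
    using assms exp_ge_add_one_self[of "-u"] by auto
  have "exp (- u) \<le> 1 / (1 + u)"
    using assms exp_ge_add_one_self[of u] by (simp add: exp_minus field_simps)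
  moreover have "1 / (1 + u) = 1 - u / (1 + u)"
    using assms by (simp add: field_simps)
  moreover have "1 / (1 + u) \<le> 1 - u + u\<^sup>2"
    using assms by (simp add: field_simps power2_eq_square power3_eq_cube)
  ultimately show "u / (1 + u) \<le> 1 - exp (- u)" "u - (1 - exp (- u)) \<le> u\<^sup>2"
    by linarith+
qed

text \<open>The base lies below 1, so the smallest admissible exponent \<open>- q\<close> is the
  worst; for it the lower bound \<open>u / (1 + u)\<close> of the base applies.\<close>

lemma one_minus_exp_powr_le:
  fixes u q r :: real
  assumes "u > 0" "q \<ge> 0" "- q \<le> r"
  shows "(1 - exp (- u)) powr r \<le> u powr (- q) * (1 + u) powr q"
proof -
  have "(1 - exp (- u)) powr r \<le> (1 - exp (- u)) powr (- q)"
    using one_minus_exp_bounds[OF assms(1)] assms by (intro powr_mono') auto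
  also have "\<dots> \<le> (u / (1 + u)) powr (- q)"
    using one_minus_exp_bounds[OF assms(1)] assms by (intro powr_mono2') auto
  also have "\<dots> = u powr (- q) * (1 + u) powr q"
    using assms by (simp add: powr_divide powr_minus field_simps)
  finally show ?thesis .
qed

text \<open>For \<open>u > 0\<close> the first exponential is
  \<open>(1 - exp (- u)) powr (s - i)\<close>.\<close>

definition newton_kernel :: "nat \<Rightarrow> real \<Rightarrow> nat \<Rightarrow> complex \<Rightarrow> real \<Rightarrow> complex" where
  "newton_kernel i w m s u =
     exp ((s - of_nat i) * of_real (ln (1 - exp (- u)))) * gamma_kernel (real i) m (of_real w) u"

definition newton_integral :: "nat \<Rightarrow> real \<Rightarrow> nat \<Rightarrow> complex \<Rightarrow> complex" where
  "newton_integral i w m s = (\<integral>u. newton_kernel i w m s u \<partial>lborel_pos)"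

lemma newton_kernel_measurable: "newton_kernel i w m s \<in> borel_measurable lborel_pos"
  unfolding newton_kernel_def
  by (intro borel_measurable_times gamma_kernel_measurable measurable_restrict_space1) measurable

lemma holomorphic_newton_kernel: "(\<lambda>s. newton_kernel i w m s u) holomorphic_on S"
  unfolding newton_kernel_def by (intro holomorphic_intros)

text \<open>The bound depends on \<open>s\<close> only through the lower bound on
  \<open>Re s\<close>, since larger real parts shrink the kernel. This is the source of growth
  estimates on whole halfplanes.\<close>

lemma norm_newton_kernel_le:
  assumes "u > 0" "q \<ge> 0" "Re s \<ge> real i - q" 
  shows "norm (newton_kernel i w m s u) \<le>
    (2 * q + 2) powr q * (exp (- ((real i - 1/2) * u)) * u powr (w - q - 1) * \<bar>ln u\<bar> ^ m)"
proof -
  have "norm (newton_kernel i w m s u) = (1 - exp (- u)) powr (Re s - real i) *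
      (exp (- (real i * u)) * u powr (w - 1) * \<bar>ln u\<bar> ^ m)"
    using assms one_minus_exp_bounds(1)[OF assms(1)]
    by (simp add: newton_kernel_def norm_mult norm_gamma_kernel powr_def)
  also have "\<dots> \<le> (u powr (- q) * ((2 * q + 2) powr q * exp (u / 2))) *
      (exp (- (real i * u)) * u powr (w - 1) * \<bar>ln u\<bar> ^ m)"
  proof (intro mult_right_mono)
    have "(1 - exp (- u)) powr (Re s - real i) \<le> u powr (- q) * (1 + u) powr q"
      using assms by (intro one_minus_exp_powr_le) auto
    also have "\<dots> \<le> u powr (- q) * ((2 * q + 2) powr q * exp (u / 2))"
      using assms by (intro mult_left_mono one_plus_powr_le_exp) auto
    finally show "(1 - exp (- u)) powr (Re s - real i) \<le> \<dots>" .
  qed auto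
  also have "\<dots> = (2 * q + 2) powr q * ((exp (u / 2) * exp (- (real i * u))) * (u powr (- q) * u powr (w - 1)) * \<bar>ln u\<bar> ^ m)"
    by (simp add: mult_ac)
  also have "exp (u / 2) * exp (- (real i * u)) = exp (- ((real i - 1/2) * u))"
    by (simp add: algebra_simps flip: exp_add)
  also have "u powr (- q) * u powr (w - 1) = u powr (w - q - 1)"
    by (simp add: algebra_simps flip: powr_add)
  finally show ?thesis .
qed

lemma
  assumes "i \<ge> 1" "w > 0" "a > real i - w"
  shows holomorphic_newton_integral_aux: "newton_integral i w m holomorphic_on right_halfplane a"
    and polybdd_newton_integral_aux: "polybdd (newton_integral i w m) (right_halfplane a)"
    and integrable_newton_kernel_aux: "Re s > a \<Longrightarrow> integrable lborel_pos (newton_kernel i w m s)"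
proof -
  \<comment> \<open>The truncation at 0 covers halfplanes with \<open>a >= i\<close>. The
    assumptions become \<open>q < w\<close>, which is integrability at \<open>u = 0\<close>.\<close>
  define q where "q = max 0 (real i - a)"
  have q: "q \<ge> 0" "q < w" "real i - q \<le> a"
    using assms by (auto simp: q_def)
  let ?g = "\<lambda>u. (2 * q + 2) powr q * (exp (- ((real i - 1/2) * u)) * u powr (w - q - 1) * \<bar>ln u\<bar> ^ m)"
  have b: "norm (newton_kernel i w m z u) \<le> (1 + norm z) ^ 0 * ?g u"
    if "z \<in> right_halfplane a" "u \<in> space lborel_pos" for z u
    using norm_newton_kernel_le[of u q i z w m] that q by (simp add: space_lborel_pos)
  have g: "integrable lborel_pos ?g"
    using assms q by (intro integrable_mult_right integrable_exp_powr_ln) auto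
  note * = open_right_halfplane holomorphic_newton_kernel newton_kernel_measurable b g
  show "newton_integral i w m holomorphic_on right_halfplane a"
    unfolding newton_integral_def by (rule holomorphic_integral_polybdd[OF *])
  show "polybdd (newton_integral i w m) (right_halfplane a)"
    unfolding newton_integral_def by (rule holomorphic_integral_polybdd[OF *])
  show "integrable lborel_pos (newton_kernel i w m s)" if "Re s > a"
    using integrable_param[OF open_right_halfplane _ holomorphic_newton_kernel newton_kernel_measurable b g] that
    by simp
qed

lemma holomorphic_on_right_halfplane:
  assumes "\<And>a. a > c \<Longrightarrow> f holomorphic_on right_halfplane a"
  shows "f holomorphic_on right_halfplane c"
  unfolding holomorphic_on_open[OF open_right_halfplane]
proof
  fix s assume "s \<in> right_halfplane c"
  then have "s \<in> right_halfplane ((c + Re s) / 2)" "(c + Re s) / 2 > c"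
    by auto
  then show "\<exists>f'. (f has_field_derivative f') (at s)"
    using assms holomorphic_on_open[OF open_right_halfplane] by blast
qed

lemma
  assumes "i \<ge> 1" "w > 0"
  shows holomorphic_newton_integral: "newton_integral i w m holomorphic_on right_halfplane (real i - w)"
    and integrable_newton_kernel: "Re s > real i - w \<Longrightarrow> integrable lborel_pos (newton_kernel i w m s)"
proof -
  show "newton_integral i w m holomorphic_on right_halfplane (real i - w)"
    by (rule holomorphic_on_right_halfplane) (rule holomorphic_newton_integral_aux[OF assms])
  show "integrable lborel_pos (newton_kernel i w m s)" if s: "Re s > real i - w"
  proof -
    obtain a where "real i - w < a" "a < Re s"
      using dense[OF s] by blast
    then show "integrable lborel_pos (newton_kernel i w m s)"
      by (rule integrable_newton_kernel_aux[OF assms])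
  qed
qed

lemma polybdd_newton_integral:
  assumes "i \<ge> 1" "w > 0" "a > real i - w"
  shows "polybdd (newton_integral i w m) {s. Re s \<ge> a}"
proof -
  obtain a' where "real i - w < a'" "a' < a"
    using dense[OF assms(3)] by blast
  then show ?thesis
    by (intro polybdd_subset[OF polybdd_newton_integral_aux[OF assms(1,2), of a' m]]) auto
qed

text \<open>Mean value inequality for \<open>t powr z\<close> along the real segment from
  \<open>x\<close> to \<open>y\<close>. The sum of both endpoint powers covers either sign of
  \<open>Re z - 1\<close>.\<close>

lemma norm_exp_ln_diff_le:
  fixes x y :: real and z :: complex
  assumes "0 < x" "x \<le> y"
  shows "norm (exp (z * of_real (ln x)) - exp (z * of_real (ln y))) \<le>
    norm z * (x powr (Re z - 1) + y powr (Re z - 1)) * (y - x)"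
proof -
  have "norm (of_real x powr z - of_real y powr z) \<le>
      norm z * (x powr (Re z - 1) + y powr (Re z - 1)) * norm (complex_of_real x - of_real y)"
  proof (rule field_differentiable_bound[where S = "complex_of_real ` {x..y}"
        and f' = "\<lambda>t. z * t powr (z - 1)"])
    have "complex_of_real ` {x..y} = closed_segment (of_real x) (of_real y)"
      using assms by (simp add: closed_segment_of_real closed_segment_eq_real_ivl)
    then show "convex (complex_of_real ` {x..y})"
      by simp
    fix t assume "t \<in> complex_of_real ` {x..y}"
    then obtain v where v: "t = of_real v" "x \<le> v" "v \<le> y"
      by auto
    then have "t \<notin> \<real>\<^sub>\<le>\<^sub>0"
      using assms by simp
    then show "((\<lambda>t. t powr z) has_field_derivative z * t powr (z - 1)) (at t within complex_of_real ` {x..y})"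
      by (rule has_field_derivative_at_within[OF has_field_derivative_powr])
    have "v powr (Re z - 1) \<le> x powr (Re z - 1) + y powr (Re z - 1)"
    proof (cases "Re z - 1 \<ge> 0")
      case True
      then have "v powr (Re z - 1) \<le> y powr (Re z - 1)"
        using assms v by (intro powr_mono2) auto
      then show ?thesis
        by (simp add: add_increasing)
    next
      case False
      then have "v powr (Re z - 1) \<le> x powr (Re z - 1)"
        using assms v by (intro powr_mono2') auto
      then show ?thesis
        by (simp add: add_increasing2)
    qed
    then show "norm (z * t powr (z - 1)) \<le> norm z * (x powr (Re z - 1) + y powr (Re z - 1))"
      using assms v by (simp add: norm_mult norm_powr_real_powr mult_left_mono)
  qed (use assms in auto)
  also have "norm (complex_of_real x - of_real y) = y - x"
    using assms by (simp add: norm_of_real flip: of_real_diff)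
  finally show ?thesis
    using assms by (simp add: powr_def Ln_of_real)
qed

text \<open>Replacing \<open>1 - exp (- u)\<close> by \<open>u\<close> in the Newton kernel costs a factor of size \<open>u\<close> near 0,
  and so gains a halfplane of width 1 to the left.\<close>

definition newton_remainder :: "nat \<Rightarrow> real \<Rightarrow> nat \<Rightarrow> complex \<Rightarrow> complex" where
  "newton_remainder i w m s =
     (\<integral>u. newton_kernel i w m s u - gamma_kernel (real i) m (s - of_nat i + of_real w) u \<partial>lborel_pos)"

lemma newton_integral_eq_gamma_integral:
  assumes "i \<ge> 1" "w > 0" "Re s > real i - w"
  shows "newton_integral i w m s =
    (\<integral>u. gamma_kernel (real i) m (s - of_nat i + of_real w) u \<partial>lborel_pos) + newton_remainder i w m s"
proof -
  have "integrable lborel_pos (newton_kernel i w m s)"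
    by (rule integrable_newton_kernel) fact+
  moreover have "integrable lborel_pos (gamma_kernel (real i) m (s - of_nat i + of_real w))"
    using assms by (intro integrable_gamma_kernel) auto
  ultimately show ?thesis
    by (simp add: newton_integral_def newton_remainder_def)
qed

text \<open>The mean value inequality yields a factor \<open>norm z\<close>, which costs one degree
  of growth, a power with exponent \<open>Re z - 1\<close>, and the distance of
  \<open>1 - exp (- u)\<close> from \<open>u\<close>, at most the square of \<open>u\<close>.
  Altogether the exponent of \<open>u\<close> is one more than in the Gamma kernel. An upper bound
  on \<open>Re s\<close> enters because \<open>u\<close>, unlike \<open>1 - exp (- u)\<close>, is
  not below 1. The exponents \<open>a + 1 - 1\<close> and \<open>b + 1 - 1\<close> have the shape
  \<open>p - 1\<close> of \<open>integrable_exp_powr_ln\<close>.\<close>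

lemma norm_newton_kernel_diff_le:
  assumes "u > 0" "K \<ge> 0" "\<bar>Re s - real i - 1\<bar> \<le> K"
    and "a \<le> Re s - real i + w" "Re s - real i + w \<le> b"
  shows "norm (newton_kernel i w m s u - gamma_kernel (real i) m (s - of_nat i + of_real w) u) \<le>
    (1 + norm s) ^ 1 * (2 * (1 + real i) * (2 * K + 2) powr K *
      (exp (- ((real i - 1/2) * u)) * u powr (a + 1 - 1) * \<bar>ln u\<bar> ^ m +
       exp (- ((real i - 1/2) * u)) * u powr (b + 1 - 1) * \<bar>ln u\<bar> ^ m))"
proof -
  define z where "z = s - of_nat i"
  define x where "x = 1 - exp (- u)"
  define p where "p = Re z - 1"
  define C where "C = (2 * K + 2) powr K"
  have x: "0 < x" "x \<le> u" "u / (1 + u) \<le> x" "u - x \<le> u\<^sup>2" "x < 1"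
    using one_minus_exp_bounds[OF assms(1)] by (auto simp: x_def)
  have p: "\<bar>p\<bar> \<le> K"
    using assms by (simp add: p_def z_def)
  have eq: "newton_kernel i w m s u - gamma_kernel (real i) m (s - of_nat i + of_real w) u =
      gamma_kernel (real i) m (of_real w) u * (exp (z * of_real (ln x)) - exp (z * of_real (ln u)))"
    by (simp add: newton_kernel_def gamma_kernel_def z_def x_def ring_distribs exp_add [symmetric] mult_ac)
       (simp add: algebra_simps flip: exp_add)
  have K1: "(1 + u) powr K \<ge> 1"
    using assms by (intro ge_one_powr_ge_zero) auto
  have "x powr p \<le> u powr p * (1 + u) powr K"
  proof (cases "p \<ge> 0")
    case True
    then have "x powr p \<le> u powr p"
      using x by (intro powr_mono2) auto
    also have "\<dots> \<le> u powr p * (1 + u) powr K"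
      using mult_left_mono[OF K1, of "u powr p"] by simp
    finally show ?thesis .
  next
    case False
    then have "x powr p \<le> (u / (1 + u)) powr p"
      using x assms by (intro powr_mono2') auto
    also have "\<dots> = u powr p * (1 + u) powr (- p)"
      using assms by (simp add: powr_divide powr_minus field_simps)
    also have "\<dots> \<le> u powr p * (1 + u) powr K"
      using assms p by (intro mult_left_mono powr_mono) auto
    finally show ?thesis .
  qed
  moreover have "u powr p \<le> u powr p * (1 + u) powr K"
    using mult_left_mono[OF K1, of "u powr p"] by simp
  ultimately have "x powr p + u powr p \<le> 2 * (u powr p * (1 + u) powr K)"
    by linarith
  also have "\<dots> \<le> 2 * (u powr p * (C * exp (u / 2)))"
    unfolding C_def using assms by (intro mult_left_mono one_plus_powr_le_exp) auto
  finally have xp: "x powr p + u powr p \<le> 2 * (u powr p * (C * exp (u / 2)))" .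
  have "norm (exp (z * of_real (ln x)) - exp (z * of_real (ln u))) \<le>
      norm z * (x powr p + u powr p) * (u - x)"
    unfolding p_def using x by (intro norm_exp_ln_diff_le) auto
  also have "\<dots> \<le> ((1 + real i) * (1 + norm s)) * (2 * (u powr p * (C * exp (u / 2)))) * u\<^sup>2"
  proof (intro mult_mono xp x)
    have "norm z \<le> norm s + real i"
      unfolding z_def using norm_triangle_ineq4[of s "of_nat i"] by simp
    also have "\<dots> \<le> (1 + real i) * (1 + norm s)"
      by (simp add: algebra_simps)
    finally show "norm z \<le> (1 + real i) * (1 + norm s)" .
  qed (use x C_def in auto)
  finally have D: "norm (exp (z * of_real (ln x)) - exp (z * of_real (ln u))) \<le>
      (1 + norm s) * (2 * (1 + real i) * C * (exp (u / 2) * (u\<^sup>2 * u powr p)))"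
    by (simp only: mult_ac)
  have u2: "u\<^sup>2 = u powr 2"
    using assms by simp
  have pow: "u powr (w - 1) * (u\<^sup>2 * u powr p) = u powr (Re s - real i + w)"
    unfolding u2 p_def z_def by (simp add: algebra_simps flip: powr_add)
  have ex: "exp (- (real i * u)) * exp (u / 2) = exp (- ((real i - 1/2) * u))"
    by (simp add: algebra_simps flip: exp_add)
  have "norm (newton_kernel i w m s u - gamma_kernel (real i) m (s - of_nat i + of_real w) u) \<le>
      (exp (- (real i * u)) * u powr (w - 1) * \<bar>ln u\<bar> ^ m) *
      ((1 + norm s) * (2 * (1 + real i) * C * (exp (u / 2) * (u\<^sup>2 * u powr p))))"
    unfolding eq norm_mult norm_gamma_kernel[OF assms(1)] using D
    by (intro mult_mono) auto
  also have "\<dots> = (1 + norm s) * (2 * (1 + real i) * C) *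
      ((exp (- (real i * u)) * exp (u / 2)) * (u powr (w - 1) * (u\<^sup>2 * u powr p)) * \<bar>ln u\<bar> ^ m)"
    by (simp only: mult_ac)
  also have "\<dots> = (1 + norm s) * (2 * (1 + real i) * C) *
      (exp (- ((real i - 1/2) * u)) * u powr (Re s - real i + w) * \<bar>ln u\<bar> ^ m)"
    unfolding pow ex ..
  also have "\<dots> \<le> (1 + norm s) * (2 * (1 + real i) * C) *
      (exp (- ((real i - 1/2) * u)) * (u powr a + u powr b) * \<bar>ln u\<bar> ^ m)"
    using assms by (intro mult_left_mono mult_right_mono powr_le_powr_add_powr) (auto simp: C_def)
  finally show ?thesis
    by (simp add: C_def algebra_simps)
qed

lemma
  assumes "i \<ge> 1" "w > 0" "a > real i - w - 1"
  shows holomorphic_newton_remainder_aux: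
      "newton_remainder i w m holomorphic_on {s. a < Re s \<and> Re s < b}"
    and polybdd_newton_remainder_aux:
      "polybdd (newton_remainder i w m) {s. a < Re s \<and> Re s < b}"
proof -
  let ?S = "{s. a < Re s \<and> Re s < b}"
  \<comment> \<open>\<open>K\<close> dominates \<open>|Re s - i - 1|\<close> on the strip. The
    maximum with 0 in \<open>?b\<close> keeps the upper exponent integrable for every
    \<open>b\<close>, including those for which the strip is empty.\<close>
  define K where "K = \<bar>a\<bar> + \<bar>b\<bar> + real i + 1"
  let ?a = "a - real i + w" and ?b = "max (b - real i + w) 0"
  let ?g = "\<lambda>u. 2 * (1 + real i) * (2 * K + 2) powr K *
      (exp (- ((real i - 1/2) * u)) * u powr (?a + 1 - 1) * \<bar>ln u\<bar> ^ m +
       exp (- ((real i - 1/2) * u)) * u powr (?b + 1 - 1) * \<bar>ln u\<bar> ^ m)"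
  have g: "integrable lborel_pos ?g"
    using assms by (intro integrable_mult_right Bochner_Integration.integrable_add integrable_exp_powr_ln) auto
  have b: "norm (newton_kernel i w m s u - gamma_kernel (real i) m (s - of_nat i + of_real w) u)
      \<le> (1 + norm s) ^ 1 * ?g u"
    if "s \<in> ?S" "u \<in> space lborel_pos" for s u
    using that assms by (intro norm_newton_kernel_diff_le) (auto simp: space_lborel_pos K_def)
  have meas: "(\<lambda>u. newton_kernel i w m s u - gamma_kernel (real i) m (s - of_nat i + of_real w) u)
      \<in> borel_measurable lborel_pos" for s
    by (intro borel_measurable_diff newton_kernel_measurable gamma_kernel_measurable)
  have hol: "(\<lambda>s. newton_kernel i w m s u - gamma_kernel (real i) m (s - of_nat i + of_real w) u)
      holomorphic_on ?S" for u
    unfolding newton_kernel_def gamma_kernel_def by (intro holomorphic_intros)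
  note * = open_strip hol meas b g
  show "newton_remainder i w m holomorphic_on ?S" "polybdd (newton_remainder i w m) ?S"
    unfolding newton_remainder_def by (rule holomorphic_integral_polybdd[OF *]; assumption)+
qed

lemma holomorphic_newton_remainder:
  assumes "i \<ge> 1" "w > 0"
  shows "newton_remainder i w m holomorphic_on right_halfplane (real i - w - 1)"
  unfolding holomorphic_on_open[OF open_right_halfplane]
proof
  fix s assume "s \<in> right_halfplane (real i - w - 1)"
  then obtain a b where ab: "real i - w - 1 < a" "a < Re s" "Re s < b"
    using dense[of "real i - w - 1" "Re s"] gt_ex[of "Re s"] by auto
  show "\<exists>f'. (newton_remainder i w m has_field_derivative f') (at s)"
    using holomorphic_newton_remainder_aux[OF assms ab(1), of m b, unfolded holomorphic_on_open[OF open_strip]] ab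
    by auto
qed

lemma polybdd_newton_remainder:
  assumes "i \<ge> 1" "w > 0" "a > real i - w - 1"
  shows "polybdd (newton_remainder i w m) {s. a < Re s \<and> Re s \<le> b}"
  by (rule polybdd_subset[OF polybdd_newton_remainder_aux[OF assms, of m "b + 1"]]) auto

subsection \<open>Summing the Newton series\<close>

lemma integral_exp_powr:
  fixes c p :: real
  assumes "c > 0" "p > 0"
  shows "(\<integral>u. exp (- (c * u)) * u powr (p - 1) \<partial>lborel_pos) = c powr (- p) * Gamma p"
proof -
  have "complex_of_real (\<integral>u. exp (- (c * u)) * u powr (p - 1) \<partial>lborel_pos) =
      (\<integral>u. complex_of_real (exp (- (c * u)) * u powr (p - 1)) \<partial>lborel_pos)"
    by (rule integral_complex_of_real [symmetric])
  also have "\<dots> = (\<integral>u. gamma_kernel c 0 (of_real p) u \<partial>lborel_pos)"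
  proof (rule Bochner_Integration.integral_cong[OF refl])
    fix u assume "u \<in> space lborel_pos"
    then have "u > 0" by (simp add: space_lborel_pos)
    then have "complex_of_real u powr (of_real p - 1) = of_real (u powr (p - 1))"
      using powr_of_real[of u "p - 1"] by simp
    then show "complex_of_real (exp (- (c * u)) * u powr (p - 1)) = gamma_kernel c 0 (of_real p) u"
      using \<open>u > 0\<close> by (simp add: gamma_kernel_altdef)
  qed
  also have "\<dots> = scaled_Gamma c (of_real p)"
    using assms by (intro gamma_integral_eq_scaled_Gamma) auto
  also have "\<dots> = of_real (c powr (- p) * Gamma p)"
    using assms powr_of_real[of c "- p"] by (simp add: scaled_Gamma_def Gamma_complex_of_real)
  finally show ?thesis
    by (simp only: of_real_eq_iff)
qed

text \<open>The decay in \<open>c\<close> is what counts: without logarithm the integral is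
  \<open>c powr (- w) * Gamma w\<close>, and the logarithm costs only \<open>c powr e\<close>. Of
  the exponents \<open>- w - e\<close> and \<open>- w + e\<close> the latter dominates as
  \<open>c >= 1\<close>.\<close>

lemma integral_norm_gamma_kernel_le:
  fixes w e :: real
  assumes "0 < e" "e < w"
  obtains K where "\<And>c. c \<ge> 1 \<Longrightarrow>
    (\<integral>u. norm (gamma_kernel c m (of_real w) u) \<partial>lborel_pos) \<le> K * c powr (e - w)"
proof -
  define A where "A = fact m / e ^ m"
  have A: "A > 0" using assms by (simp add: A_def)
  have "(\<integral>u. norm (gamma_kernel c m (of_real w) u) \<partial>lborel_pos) \<le>
      A * (Gamma (w + e) + Gamma (w - e)) * c powr (e - w)" if c: "c \<ge> 1" for c
  proof -
    let ?h = "\<lambda>p u. exp (- (c * u)) * u powr (p - 1)"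
    have int: "integrable lborel_pos (?h (w + e))" "integrable lborel_pos (?h (w - e))"
      using assms c by (auto intro!: integrable_exp_powr)
    have "(\<integral>u. norm (gamma_kernel c m (of_real w) u) \<partial>lborel_pos) \<le>
        (\<integral>u. A * (?h (w + e) u + ?h (w - e) u) \<partial>lborel_pos)"
    proof (rule integral_mono)
      show "integrable lborel_pos (\<lambda>u. norm (gamma_kernel c m (of_real w) u))"
        using assms c by (intro integrable_norm integrable_gamma_kernel) auto
      show "integrable lborel_pos (\<lambda>u. A * (?h (w + e) u + ?h (w - e) u))"
        using int by simp
      fix u assume "u \<in> space lborel_pos"
      then have u: "u > 0" by (simp add: space_lborel_pos)
      have "norm (gamma_kernel c m (of_real w) u) \<le> exp (- (c * u)) * u powr (w - 1) * (A * (u powr e + u powr (- e)))"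
        unfolding norm_gamma_kernel[OF u] A_def Re_complex_of_real
        using abs_ln_power_le[OF u assms(1), of m] by (intro mult_left_mono) auto
      also have "\<dots> = A * (exp (- (c * u)) * (u powr (w - 1) * u powr e) + exp (- (c * u)) * (u powr (w - 1) * u powr (- e)))"
        by (simp add: algebra_simps)
      also have "u powr (w - 1) * u powr e = u powr (w + e - 1)"
        by (simp add: algebra_simps flip: powr_add)
      also have "u powr (w - 1) * u powr (- e) = u powr (w - e - 1)"
        by (simp add: algebra_simps flip: powr_add)
      finally show "norm (gamma_kernel c m (of_real w) u) \<le> A * (?h (w + e) u + ?h (w - e) u)" .
    qed
    also have "\<dots> = A * (c powr (- (w + e)) * Gamma (w + e) + c powr (- (w - e)) * Gamma (w - e))"
      using int assms c by (simp add: integral_exp_powr)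
    also have "\<dots> \<le> A * (c powr (e - w) * Gamma (w + e) + c powr (e - w) * Gamma (w - e))"
      using assms A c by (intro mult_left_mono add_mono mult_right_mono powr_mono) (auto simp: Gamma_real_nonneg)
    finally show ?thesis
      by (simp add: algebra_simps)
  qed
  then show thesis
    by (rule that)
qed

text \<open>Boundedness of a convergent sequence, applied to the asymptotics of the binomial
  coefficients; \<open>n = 0\<close> is excluded since \<open>0 powr x = 0\<close>.\<close>

lemma norm_gchoose_le:
  fixes z :: complex
  obtains M where "\<And>n. n \<ge> 1 \<Longrightarrow> norm (z gchoose n) \<le> M * real n powr (- (Re z + 1))"
proof -
  have "Bseq (\<lambda>n. (z gchoose n) / ((-1) ^ n / exp ((z + 1) * of_real (ln (real n)))))"
    using gbinomial_asymptotic[of z] by (intro convergent_imp_Bseq convergentI)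
  then obtain M where M: "\<And>n. norm ((z gchoose n) / ((-1) ^ n / exp ((z + 1) * of_real (ln (real n))))) \<le> M"
    unfolding Bseq_def by blast
  have "norm (z gchoose n) \<le> M * real n powr (- (Re z + 1))" if "n \<ge> 1" for n
  proof -
    have "norm (z gchoose n) * real n powr (Re z + 1) \<le> M"
      using M[of n] that by (simp add: norm_mult norm_divide norm_power powr_def)
    then show ?thesis
      using that by (simp only: powr_minus) (simp add: field_simps)
  qed
  then show thesis
    by (rule that)
qed

text \<open>The factors are at most of order \<open>j powr (- (Re z + 1))\<close> and
  \<open>j powr (e - w)\<close>; the exponents add up to less than -1 precisely when
  \<open>e < Re z + w\<close>. With \<open>z = s - i\<close> this leaves room for some
  \<open>e > 0\<close> exactly on the halfplane \<open>Re s > i - w\<close>.\<close>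

lemma summable_gchoose_gamma_norm:
  fixes w :: real and z :: complex
  assumes "w > 0" "Re z + w > 0" "i \<ge> 1"
  shows "summable (\<lambda>j. norm (z gchoose j) *
    (\<integral>u. norm (gamma_kernel (real (j + i)) m (of_real w) u) \<partial>lborel_pos))"
proof -
  define e where "e = min w (Re z + w) / 2"
  have e: "0 < e" "e < w" "e < Re z + w"
    using assms by (auto simp: e_def min_def)
  obtain K where K: "\<And>c. c \<ge> 1 \<Longrightarrow>
      (\<integral>u. norm (gamma_kernel c m (of_real w) u) \<partial>lborel_pos) \<le> K * c powr (e - w)"
    using integral_norm_gamma_kernel_le[OF e(1,2)] by blast
  obtain M where M: "\<And>n. n \<ge> 1 \<Longrightarrow> norm (z gchoose n) \<le> M * real n powr (- (Re z + 1))"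
    using norm_gchoose_le by blast
  have K0: "K \<ge> 0"
    using order_trans[OF Bochner_Integration.integral_nonneg K[of 1]] by simp
  have "summable (\<lambda>j. M * K * real j powr (- (Re z + 1) + (e - w)))"
    using e by (intro summable_mult) (simp add: summable_real_powr_iff)
  then show ?thesis
  proof (rule summable_comparison_test'[where N = 1])
    fix j :: nat assume j: "j \<ge> 1"
    have "(\<integral>u. norm (gamma_kernel (real (j + i)) m (of_real w) u) \<partial>lborel_pos) \<le> K * real (j + i) powr (e - w)"
      using j by (intro K) simp
    also have "\<dots> \<le> K * real j powr (e - w)"
      using j e K0 by (intro mult_left_mono powr_mono2') auto
    finally have "norm (z gchoose j) * (\<integral>u. norm (gamma_kernel (real (j + i)) m (of_real w) u) \<partial>lborel_pos) \<le>
        (M * real j powr (- (Re z + 1))) * (K * real j powr (e - w))"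
      using M[OF j] by (intro mult_mono) (auto intro: order_trans[OF norm_ge_zero])
    also have "\<dots> = M * K * real j powr (- (Re z + 1) + (e - w))"
      by (simp add: powr_add mult_ac)
    finally show "norm (norm (z gchoose j) * (\<integral>u. norm (gamma_kernel (real (j + i)) m (of_real w) u) \<partial>lborel_pos)) \<le>
        M * K * real j powr (- (Re z + 1) + (e - w))"
      by simp
  qed
qed

text \<open>Each further factor \<open>exp (- u)\<close> of the binomial series for
  \<open>(1 - exp (- u)) powr (s - i)\<close> raises the parameter of the Gamma kernel by 1, from
  \<open>i\<close> to \<open>j + i\<close>. Summability of the integrals of the norms justifies the
  exchange of sum and integral.\<close>

lemma newton_integral_sums:
  fixes w :: real
  assumes "i \<ge> 1" "w > 0" "Re s > real i - w"
  shows "(\<lambda>j. (-1) ^ j * ((s - of_nat i) gchoose j) *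
      (\<integral>u. gamma_kernel (real (j + i)) m (of_real w) u \<partial>lborel_pos)) sums newton_integral i w m s"
proof -
  define z where "z = s - of_nat i"
  let ?f = "\<lambda>j u. (-1) ^ j * (z gchoose j) * gamma_kernel (real (j + i)) m (of_real w) u"
  have f_eq: "?f j u = (z gchoose j) * (- of_real (exp (- u))) ^ j * gamma_kernel (real i) m (of_real w) u" for j u
  proof -
    have "exp (- (real (j + i) * u)) = exp (- u) ^ j * exp (- (real i * u))"
      by (simp add: algebra_simps flip: exp_of_nat_mult exp_add)
    then have "complex_of_real (exp (- (real (j + i) * u))) =
        of_real (exp (- u)) ^ j * of_real (exp (- (real i * u)))"
      by (simp only: of_real_mult of_real_power)
    moreover have "(- complex_of_real (exp (- u))) ^ j = (-1) ^ j * of_real (exp (- u)) ^ j"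
      by (rule power_minus)
    ultimately show ?thesis
      unfolding gamma_kernel_def by (simp only: mult_ac)
  qed
  have f_sums: "(\<lambda>j. ?f j u) sums newton_kernel i w m s u" if "u > 0" for u
  proof -
    have "1 - exp (- u) > 0"
      using that by simp
    then have p: "(1 + - complex_of_real (exp (- u))) powr z = exp (z * of_real (ln (1 - exp (- u))))"
      using Ln_of_real[of "1 - exp (- u)"] by (simp add: powr_def)
    have "(\<lambda>j. (z gchoose j) * (- complex_of_real (exp (- u))) ^ j) sums (1 + - of_real (exp (- u))) powr z"
      using that by (intro gen_binomial_complex) simp
    then show ?thesis
      unfolding f_eq p newton_kernel_def z_def [symmetric] by (rule sums_mult2)
  qed
  have f_summable: "summable (\<lambda>j. norm (?f j u))" if "u > 0" for u
  proof -
    have "ereal (norm (- complex_of_real (exp (- u)))) < conv_radius (\<lambda>n. z gchoose n)"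
      using that by (simp add: conv_radius_gchoose)
    then have "summable (\<lambda>j. norm ((z gchoose j) * (- complex_of_real (exp (- u))) ^ j))"
      by (rule abs_summable_in_conv_radius)
    then show ?thesis
      unfolding f_eq norm_mult[of _ "gamma_kernel _ _ _ _"] by (rule summable_mult2)
  qed
  have "(\<lambda>j. \<integral>u. ?f j u \<partial>lborel_pos) sums (\<integral>u. (\<Sum>j. ?f j u) \<partial>lborel_pos)"
  proof (rule sums_integral)
    show "integrable lborel_pos (?f j)" for j
      using assms by (intro integrable_mult_right integrable_gamma_kernel) auto
    show "AE u in lborel_pos. summable (\<lambda>j. norm (?f j u))"
      using f_summable by (intro AE_I2) (simp only: space_lborel_pos)
    show "summable (\<lambda>j. \<integral>u. norm (?f j u) \<partial>lborel_pos)"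
      using summable_gchoose_gamma_norm[of w z i m] assms
      by (simp add: norm_mult norm_power z_def)
  qed
  also have "(\<integral>u. (\<Sum>j. ?f j u) \<partial>lborel_pos) = newton_integral i w m s"
    unfolding newton_integral_def using f_sums
    by (intro Bochner_Integration.integral_cong refl) (simp only: space_lborel_pos sums_unique[symmetric])
  finally show ?thesis
    by (simp add: z_def)
qed

section \<open>Falling factorials, Stirling numbers and the shift of the summation index\<close>

lemma falling_Suc: "falling s (Suc k) = falling s k * (s - of_nat k)"
  by (simp add: falling_def)

lemma falling_add: "falling s (i + j) = falling s i * falling (s - of_nat i) j"
  by (induction j) (simp_all add: falling_Suc falling_def[of _ 0] algebra_simps)

lemma falling_gchoose: "falling s k = fact k * (s gchoose k)"
  by (simp add: falling_def gbinomial_prod_rev atLeast0LessThan)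

lemma falling_of_nat_eq_0: "k < i \<Longrightarrow> falling (of_nat k) i = 0"
  by (auto simp: falling_def intro!: prod_zero)

lemma falling_of_nat_add: "falling (of_nat (j + i)) i * fact j = fact (j + i)"
proof (induction i arbitrary: j)
  case 0
  then show ?case by (simp add: falling_def)
next
  case (Suc i)
  have "falling (of_nat (j + Suc i)) (Suc i) * fact j = falling (of_nat (Suc j + i)) i * fact (Suc j)"
    by (simp add: falling_Suc algebra_simps)
  also have "\<dots> = fact (Suc j + i)"
    by (rule Suc.IH)
  finally show ?case
    by simp
qed

text \<open>Induction by \<open>x * falling x k = falling x (Suc k) + k * falling x k\<close>, which
  mirrors the recurrence of \<open>Stirling\<close>.\<close>

lemma power_eq_sum_Stirling_falling:
  "x ^ n = (\<Sum>k\<le>n. of_nat (Stirling n k) * falling x k)"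
proof (induction n)
  case 0
  then show ?case by (simp add: falling_def)
next
  case (Suc n)
  let ?f = "\<lambda>k. of_nat (k * Stirling n k) * falling x k"
  \<comment> \<open>The index can be shifted because the term at 0 vanishes by its factor
    \<open>k\<close> and the term at \<open>Suc n\<close> by
    \<open>Stirling n (Suc n) = 0\<close>.\<close>
  have "(\<Sum>k\<le>n. ?f k) = (\<Sum>k\<le>Suc n. ?f k)"
    by (simp add: Stirling_less)
  also have "\<dots> = (\<Sum>k\<le>n. ?f (Suc k))"
    by (subst sum.atMost_Suc_shift) simp
  finally have shift: "(\<Sum>k\<le>n. ?f k) = (\<Sum>k\<le>n. ?f (Suc k))" .
  have "x ^ Suc n = (\<Sum>k\<le>n. of_nat (Stirling n k) * falling x k * x)"
    using Suc by (simp add: sum_distrib_left mult_ac)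
  also have "\<dots> = (\<Sum>k\<le>n. of_nat (Stirling n k) * falling x (Suc k)) + (\<Sum>k\<le>n. ?f k)"
    unfolding sum.distrib[symmetric] by (intro sum.cong refl) (simp add: falling_Suc algebra_simps)
  also have "\<dots> = (\<Sum>k\<le>n. of_nat (Stirling (Suc n) (Suc k)) * falling x (Suc k))"
    unfolding shift sum.distrib[symmetric] by (intro sum.cong refl) (simp add: algebra_simps)
  also have "\<dots> = (\<Sum>k\<le>Suc n. of_nat (Stirling (Suc n) k) * falling x k)"
    by (subst sum.atMost_Suc_shift) simp
  finally show ?case .
qed

text \<open>The factor \<open>falling k i\<close> kills the terms with \<open>k < i\<close>. For
  \<open>k = j + i\<close> it reduces \<open>1 / fact k\<close> to \<open>1 / fact j\<close>, while
  \<open>falling s k\<close> splits off \<open>falling s i\<close>. What remains is a binomial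
  series in \<open>s - i\<close>, and the shift leaves the sign \<open>(-1) ^ i\<close>.\<close>

lemma newton_term_sums:
  fixes w :: real
  assumes "i \<ge> 1" "w > 0" "Re s > real i - w"
  shows "(\<lambda>k. (-1) ^ k / fact k * falling s k * (falling (of_nat k) i *
      (\<integral>u. gamma_kernel (real k) m (of_real w) u \<partial>lborel_pos)))
    sums ((-1) ^ i * falling s i * newton_integral i w m s)"
proof -
  let ?L = "\<lambda>k. \<integral>u. gamma_kernel (real k) m (of_real w) u \<partial>lborel_pos"
  have "(\<lambda>j. (-1) ^ (j + i) / fact (j + i) * falling s (j + i) * (falling (of_nat (j + i)) i * ?L (j + i))) =
      (\<lambda>j. (-1) ^ i * falling s i * ((-1) ^ j * ((s - of_nat i) gchoose j) * ?L (j + i)))"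
  proof
    fix j
    have "falling (of_nat (j + i)) i / fact (j + i) = 1 / fact j"
      using falling_of_nat_add[of j i] by (simp add: field_simps)
    moreover have "falling s (j + i) = falling s i * (fact j * ((s - of_nat i) gchoose j))"
      using falling_add[of s i j] by (simp add: falling_gchoose[of "s - of_nat i"] add.commute)
    moreover have "(-1) ^ (j + i) / fact (j + i) * falling s (j + i) * (falling (of_nat (j + i)) i * ?L (j + i)) =
        (-1) ^ j * (-1) ^ i * falling s (j + i) * (falling (of_nat (j + i)) i / fact (j + i)) * ?L (j + i)"
      by (simp add: power_add)
    ultimately show "(-1) ^ (j + i) / fact (j + i) * falling s (j + i) * (falling (of_nat (j + i)) i * ?L (j + i)) =
        (-1) ^ i * falling s i * ((-1) ^ j * ((s - of_nat i) gchoose j) * ?L (j + i))"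
      by simp
  qed
  then have "(\<lambda>j. (-1) ^ (j + i) / fact (j + i) * falling s (j + i) * (falling (of_nat (j + i)) i * ?L (j + i)))
      sums ((-1) ^ i * falling s i * newton_integral i w m s)"
    using sums_mult[OF newton_integral_sums[OF assms, of m], of "(-1) ^ i * falling s i"] by simp
  then show ?thesis
    by (subst (asm) sums_zero_iff_shift) (auto simp: falling_of_nat_eq_0)
qed

text \<open>\<open>tame_coeff\<close> differs from these coefficients only by the sign that the
  index shift produces.\<close>

definition leibniz_coeff :: "real \<Rightarrow> nat \<Rightarrow> nat \<Rightarrow> complex" where
  "leibniz_coeff w b m = (-1) ^ b * of_nat (b choose m) * (deriv ^^ (b - m)) rGamma (of_real w)"

lemma powr_ln_power_eq_sum_falling:
  fixes w :: real
  assumes "w > 0" "l \<ge> 1" "k \<ge> 1"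
  shows "of_real (real k powr (real l - w) * ln (real k) ^ b) =
    (\<Sum>i=1..l. \<Sum>m\<le>b. of_nat (Stirling l i) * leibniz_coeff w b m *
       (falling (of_nat k) i * (\<integral>u. gamma_kernel (real k) m (of_real w) u \<partial>lborel_pos)))"
proof -
  \<comment> \<open>As \<open>l >= 1\<close>, \<open>Stirling l 0 = 0\<close>: the sum starts at
    \<open>i = 1\<close>, where the Newton integrals converge at infinity.\<close>
  have "{..l} = insert 0 {1..l}" by auto
  then have S: "of_nat k ^ l = (\<Sum>i=1..l. of_nat (Stirling l i) * falling (of_nat k) i)"
    using power_eq_sum_Stirling_falling[of "of_nat k" l] assms by (cases l) simp_all
  have "real k powr (real l - w) * ln (real k) ^ b = real k ^ l * (real k powr (- w) * ln (real k) ^ b)"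
    using assms by (simp add: powr_diff powr_minus powr_realpow field_simps)
  then have "complex_of_real (real k powr (real l - w) * ln (real k) ^ b) =
      of_nat k ^ l * of_real (real k powr (- w) * ln (real k) ^ b)"
    by (simp only: of_real_mult of_real_power of_real_of_nat_eq)
  also have "of_real (real k powr (- w) * ln (real k) ^ b) =
      (\<Sum>m\<le>b. leibniz_coeff w b m * (\<integral>u. gamma_kernel (real k) m (of_real w) u \<partial>lborel_pos))"
    using assms by (subst powr_ln_power_eq_gamma_integrals) (auto simp: leibniz_coeff_def sum_distrib_left mult_ac)
  finally show ?thesis
    unfolding S by (simp add: sum_product mult_ac)
qed

text \<open>The first two terms account for the arbitrary values \<open>F 0\<close> and
  \<open>F 1\<close>: the Stirling expansion contributes 0 at \<open>k = 0\<close> and, since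
  \<open>ln 1 = 0\<close>, the value \<open>0 ^ b\<close> at \<open>k = 1\<close>.\<close>

definition newton_sum :: "real \<Rightarrow> nat \<Rightarrow> (nat \<Rightarrow> real) \<Rightarrow> complex \<Rightarrow> complex" where
  "newton_sum d b F s = of_real (F 0) - of_real (F 1 - 0 ^ b) * s +
     (\<Sum>i=1..sigma_deg d. \<Sum>m\<le>b. of_nat (Stirling (sigma_deg d) i) * leibniz_coeff (real (sigma_deg d) - d) b m *
        ((-1) ^ i * falling s i * newton_integral i (real (sigma_deg d) - d) m s))"

lemma sigma_deg_bounds: "sigma_deg d \<ge> 1" "real (sigma_deg d) - d > 1"
  unfolding sigma_deg_def by (auto; linarith)+

lemma newton_series_sums:
  assumes "basic_sequence d b F" "Re s > d"
  shows "(\<lambda>k. (-1) ^ k * (of_real (F k) / fact k) * falling s k) sums newton_sum d b F s"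
proof -
  define l where "l = sigma_deg d"
  define w where "w = real l - d"
  have l: "l \<ge> 1" "w > 0" "real l - w = d"
    using sigma_deg_bounds[of d] by (auto simp: l_def w_def)
  let ?T = "\<lambda>i m k. (-1) ^ k / fact k * falling s k * (falling (of_nat k) i *
      (\<integral>u. gamma_kernel (real k) m (of_real w) u \<partial>lborel_pos))"
  define E where "E = (\<lambda>k::nat. if k = 0 then complex_of_real (F 0) else if k = 1 then - of_real (F 1 - 0 ^ b) * s else 0)"
  have sums: "(\<lambda>k. \<Sum>i=1..l. \<Sum>m\<le>b. of_nat (Stirling l i) * leibniz_coeff w b m * ?T i m k) sums
      (\<Sum>i=1..l. \<Sum>m\<le>b. of_nat (Stirling l i) * leibniz_coeff w b m *
        ((-1) ^ i * falling s i * newton_integral i w m s))"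
    using l assms by (intro sums_sum sums_mult newton_term_sums) (auto simp: w_def)
  have E: "E sums (\<Sum>k\<in>{0,1}. E k)"
    by (rule sums_finite) (auto simp: E_def)
  have eq: "newton_sum d b F s = (\<Sum>k\<in>{0,1}. E k) +
      (\<Sum>i=1..l. \<Sum>m\<le>b. of_nat (Stirling l i) * leibniz_coeff w b m *
        ((-1) ^ i * falling s i * newton_integral i w m s))"
    by (simp add: newton_sum_def E_def l_def w_def left_diff_distrib)
  have "(\<lambda>k. E k + (\<Sum>i=1..l. \<Sum>m\<le>b. of_nat (Stirling l i) * leibniz_coeff w b m * ?T i m k)) sums newton_sum d b F s"
    unfolding eq by (rule sums_add[OF E sums])
  also have "(\<lambda>k. E k + (\<Sum>i=1..l. \<Sum>m\<le>b. of_nat (Stirling l i) * leibniz_coeff w b m * ?T i m k)) =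
      (\<lambda>k. (-1) ^ k * (of_real (F k) / fact k) * falling s k)"
  proof
    fix k
    show "E k + (\<Sum>i=1..l. \<Sum>m\<le>b. of_nat (Stirling l i) * leibniz_coeff w b m * ?T i m k) =
      (-1) ^ k * (of_real (F k) / fact k) * falling s k"
    proof (cases "k = 0")
      case True
      have "(\<Sum>i=1..l. \<Sum>m\<le>b. of_nat (Stirling l i) * leibniz_coeff w b m * ?T i m k) = 0"
        using True falling_of_nat_eq_0[of 0] by (intro sum.neutral ballI) simp
      then show ?thesis
        using True by (simp add: E_def falling_def)
    next
      case False
      have "(\<Sum>i=1..l. \<Sum>m\<le>b. of_nat (Stirling l i) * leibniz_coeff w b m * ?T i m k) =
          (-1) ^ k / fact k * falling s k * of_real (real k powr d * ln (real k) ^ b)"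
        using powr_ln_power_eq_sum_falling[OF l(2,1), of k b] False
        unfolding l(3) by (simp add: sum_distrib_left mult_ac)
      moreover have "real k powr d * ln (real k) ^ b = F k" if "k \<ge> 2"
        using assms(1) that by (simp add: basic_sequence_def)
      ultimately show ?thesis
        using False by (cases "k = 1") (auto simp: E_def falling_def algebra_simps)
    qed
  qed
  finally show ?thesis .
qed

subsection \<open>Continuation to the left and tameness\<close>

text \<open>Everything in \<open>newton_sum\<close> except the Gamma part of the term
  \<open>i = l\<close>. For \<open>i < l\<close> the integrals converge for
  \<open>Re s > i - w\<close>, where \<open>i - w <= d - 1\<close>; the remainder for
  \<open>i = l\<close> reaches equally far.\<close>

definition newton_regular :: "real \<Rightarrow> nat \<Rightarrow> (nat \<Rightarrow> real) \<Rightarrow> complex \<Rightarrow> complex" where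
  "newton_regular d b F s = of_real (F 0) - of_real (F 1 - 0 ^ b) * s +
     (\<Sum>i\<in>{1..<sigma_deg d}. \<Sum>m\<le>b. of_nat (Stirling (sigma_deg d) i) * leibniz_coeff (real (sigma_deg d) - d) b m *
        ((-1) ^ i * falling s i * newton_integral i (real (sigma_deg d) - d) m s)) +
     falling s (sigma_deg d) *
       (\<Sum>m\<le>b. tame_coeff d b m * newton_remainder (sigma_deg d) (real (sigma_deg d) - d) m s)"

lemma tame_coeff_eq: "tame_coeff d b m = (-1) ^ sigma_deg d * leibniz_coeff (real (sigma_deg d) - d) b m"
  by (simp add: tame_coeff_def leibniz_coeff_def power_add)

lemma newton_sum_eq:
  assumes "Re s > d"
  shows "newton_sum d b F s = falling s (sigma_deg d) *
    (\<Sum>m\<le>b. tame_coeff d b m * (deriv ^^ m) (scaled_Gamma (real (sigma_deg d))) (s - of_real d)) + newton_regular d b F s"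
proof -
  define l where "l = sigma_deg d"
  define w where "w = real l - d"
  have l: "l \<ge> 1" "w > 0"
    using sigma_deg_bounds[of d] by (auto simp: l_def w_def)
  let ?t = "\<lambda>i m. of_nat (Stirling l i) * leibniz_coeff w b m * ((-1) ^ i * falling s i * newton_integral i w m s)"
  have int: "newton_integral l w m s = (deriv ^^ m) (scaled_Gamma (real l)) (s - of_real d) + newton_remainder l w m s" for m
    using l assms by (simp add: newton_integral_eq_gamma_integral higher_deriv_scaled_Gamma w_def)
  have "{1..l} = insert l {1..<l}"
    using l by auto
  then have "(\<Sum>i=1..l. \<Sum>m\<le>b. ?t i m) = (\<Sum>m\<le>b. ?t l m) + (\<Sum>i\<in>{1..<l}. \<Sum>m\<le>b. ?t i m)"
    by simp
  moreover have "(\<Sum>m\<le>b. ?t l m) =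
      falling s l * (\<Sum>m\<le>b. tame_coeff d b m * (deriv ^^ m) (scaled_Gamma (real l)) (s - of_real d)) +
      falling s l * (\<Sum>m\<le>b. tame_coeff d b m * newton_remainder l w m s)"
    unfolding sum_distrib_left sum.distrib [symmetric] int tame_coeff_eq l_def [symmetric] w_def [symmetric]
    by (intro sum.cong refl) (simp add: algebra_simps)
  ultimately show ?thesis
    unfolding newton_sum_def newton_regular_def l_def [symmetric] w_def [symmetric] by (simp add: add_ac)
qed

lemma holomorphic_newton_regular: "newton_regular d b F holomorphic_on right_halfplane (d - 1)"
  unfolding newton_regular_def
proof (intro holomorphic_intros holomorphic_falling)
  fix i m assume "i \<in> {1..<sigma_deg d}"
  then show "newton_integral i (real (sigma_deg d) - d) m holomorphic_on right_halfplane (d - 1)"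
    using sigma_deg_bounds[of d] by (intro holomorphic_on_subset[OF holomorphic_newton_integral]) auto
next
  fix m
  show "newton_remainder (sigma_deg d) (real (sigma_deg d) - d) m holomorphic_on right_halfplane (d - 1)"
    using holomorphic_newton_remainder[of "sigma_deg d" "real (sigma_deg d) - d" m] sigma_deg_bounds[of d] by simp
qed

lemma polybdd_newton_regular:
  assumes "a > d - 1"
  shows "polybdd (newton_regular d b F) {s. a < Re s \<and> Re s \<le> x}"
  unfolding newton_regular_def
proof (intro polybdd_add polybdd_diff polybdd_mult polybdd_sum polybdd_const polybdd_id polybdd_falling)
  fix i m assume "i \<in> {1..<sigma_deg d}"
  then show "polybdd (newton_integral i (real (sigma_deg d) - d) m) {s. a < Re s \<and> Re s \<le> x}"
    using sigma_deg_bounds[of d] assms by (intro polybdd_subset[OF polybdd_newton_integral[where a = a]]) auto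
next
  fix m
  show "polybdd (newton_remainder (sigma_deg d) (real (sigma_deg d) - d) m) {s. a < Re s \<and> Re s \<le> x}"
    using sigma_deg_bounds[of d] assms by (intro polybdd_newton_remainder) auto
qed

lemma polybdd_newton_sum:
  assumes "a > d"
  shows "polybdd (newton_sum d b F) {s. Re s \<ge> a}"
  unfolding newton_sum_def
proof (intro polybdd_add polybdd_diff polybdd_mult polybdd_sum polybdd_const polybdd_id polybdd_falling)
  fix i m assume "i \<in> {1..sigma_deg d}"
  then show "polybdd (newton_integral i (real (sigma_deg d) - d) m) {s. Re s \<ge> a}"
    using sigma_deg_bounds[of d] assms by (intro polybdd_newton_integral) auto
qed

lemma holomorphic_newton_sum: "newton_sum d b F holomorphic_on right_halfplane d"
  unfolding newton_sum_def
proof (intro holomorphic_intros holomorphic_falling)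
  fix i m assume "i \<in> {1..sigma_deg d}"
  then show "newton_integral i (real (sigma_deg d) - d) m holomorphic_on right_halfplane d"
    using sigma_deg_bounds[of d] by (intro holomorphic_on_subset[OF holomorphic_newton_integral]) auto
qed

lemma holomorphic_higher_deriv_Gamma_reg_shift:
  assumes "c \<ge> 1"
  shows "(\<lambda>s. (deriv ^^ m) (Gamma_reg c) (s - of_real d)) holomorphic_on right_halfplane (d - 1)"
proof -
  have "(deriv ^^ m) (Gamma_reg c) \<circ> (\<lambda>s. s - of_real d) holomorphic_on right_halfplane (d - 1)"
  proof (rule holomorphic_on_compose_gen)
    show "(deriv ^^ m) (Gamma_reg c) holomorphic_on right_halfplane (-1)"
      by (intro holomorphic_higher_deriv holomorphic_Gamma_reg open_right_halfplane assms)
  qed (auto intro!: holomorphic_intros)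
  then show ?thesis
    by (simp add: o_def)
qed

lemma polybdd_higher_deriv_Gamma_reg_shift:
  assumes "c \<ge> 1"
  shows "polybdd (\<lambda>s. (deriv ^^ m) (Gamma_reg c) (s - of_real d)) {s. d - 1/4 < Re s \<and> Re s \<le> x}"
proof -
  obtain C where C: "\<And>z. -1/4 \<le> Re z \<Longrightarrow> Re z \<le> x - d \<Longrightarrow> norm ((deriv ^^ m) (Gamma_reg c) z) \<le> C"
    using bounded_higher_deriv_Gamma_reg[OF assms] by blast
  show ?thesis
    by (rule polybdd_bounded[of _ _ C], rule C) auto
qed

lemma sigma_deg_of_nat: "sigma_deg (real n) = n + 2"
  by (simp add: sigma_deg_def)

text \<open>For \<open>d \<in> \<nat>\<close> the factor \<open>falling s (sigma_deg d)\<close> has a simple zero at \<open>d\<close>, which lowers the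
  order of the pole by one.\<close>

lemma falling_sigma_deg_factor:
  obtains q where "q holomorphic_on UNIV" "\<And>S. polybdd q S" "q (of_real d) \<noteq> 0"
    "\<And>s. falling s (sigma_deg d) = (s - of_real d) ^ (if d \<in> \<nat> then 1 else 0) * q s"
proof (cases "d \<in> \<nat>")
  case True
  then obtain n where n: "d = real n"
    by (auto elim!: Nats_cases)
  \<comment> \<open>The factor with \<open>i = n\<close> is present because
    \<open>n < n + 2\<close>; without it the product has no zero at \<open>n\<close>.\<close>
  define q where "q = (\<lambda>s::complex. \<Prod>i\<in>{..<n+2} - {n}. s - of_nat i)"
  show thesis
  proof (rule that[of q])
    show "q holomorphic_on UNIV"
      unfolding q_def by (intro holomorphic_intros)
    show "polybdd q S" for S
      unfolding q_def by (intro polybdd_prod polybdd_diff polybdd_id polybdd_const)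
    show "q (of_real d) \<noteq> 0"
      by (auto simp: q_def n)
    have "falling s (n + 2) = (s - of_nat n) * q s" for s
      unfolding falling_def q_def by (rule prod.remove) auto
    then show "falling s (sigma_deg d) = (s - of_real d) ^ (if d \<in> \<nat> then 1 else 0) * q s" for s
      using True by (simp add: n sigma_deg_of_nat)
  qed
next
  case False
  show thesis
  proof (rule that[of "\<lambda>s. falling s (sigma_deg d)"])
    have "complex_of_real d \<noteq> of_nat i" for i
      using False by (metis of_nat_in_Nats of_real_eq_iff of_real_of_nat_eq)
    then show "falling (of_real d) (sigma_deg d) \<noteq> 0"
      by (simp add: falling_def)
  qed (use False in \<open>auto intro!: holomorphic_falling polybdd_falling\<close>)
qed

text \<open>For \<open>m = b\<close> no derivative of \<open>rGamma\<close> occurs, and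
  \<open>rGamma\<close> has no zero with positive real part. This coefficient governs the leading
  term at the pole.\<close>

lemma tame_coeff_top_nonzero: "tame_coeff d b b \<noteq> 0"
  using not_nonpos_Int_of_Re[of "of_real (real (sigma_deg d) - d)"] sigma_deg_bounds(2)[of d]
  by (auto simp: tame_coeff_def rGamma_eq_zero_iff)

text \<open>At an integer \<open>n\<close> the series terminates, and
  \<open>falling n k / fact k\<close> is the binomial coefficient; so the interpolation property
  follows from uniqueness of sums.\<close>

lemma newton_lifting_if_sums:
  assumes "\<Psi> holomorphic_on right_halfplane d"
    and sums: "\<And>s. Re s > d \<Longrightarrow> (\<lambda>k. (-1) ^ k * (of_real (F k) / fact k) * falling s k) sums \<Psi> s"
  shows "newton_lifting F d \<Psi>"
  unfolding newton_lifting_def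
proof (intro conjI allI impI ballI)
  fix n :: nat assume n: "real n > d"
  have "(\<lambda>k. (-1) ^ k * (of_real (F k) / fact k) * falling (of_nat n) k) sums
      (\<Sum>k\<le>n. (-1) ^ k * (of_real (F k) / fact k) * falling (of_nat n) k)"
    by (rule sums_finite) (auto simp: falling_of_nat_eq_0)
  moreover have "(-1) ^ k * (of_real (F k) / fact k) * falling (of_nat n) k =
      complex_of_real ((-1) ^ k * real (n choose k) * F k)" for k
    by (simp add: falling_gchoose binomial_gbinomial [symmetric])
  ultimately have "(\<lambda>k. (-1) ^ k * (of_real (F k) / fact k) * falling (of_nat n) k) sums of_real (Pi_seq F n)"
    by (simp add: Pi_seq_def)
  moreover have "(\<lambda>k. (-1) ^ k * (of_real (F k) / fact k) * falling (of_nat n) k) sums \<Psi> (of_nat n)"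
    using n by (intro sums) simp
  ultimately show "\<Psi> (of_nat n) = of_real (Pi_seq F n)"
    by (rule sums_unique2[rotated])
qed (use assms in auto)

lemma S_shapeI:
  assumes g: "g holomorphic_on right_halfplane (c - \<delta>)" "R holomorphic_on right_halfplane (c - \<delta>)"
    and "g (of_real c) \<noteq> 0" "\<delta> > 0"
    and f: "f = (\<lambda>s. g s / (s - of_real c) ^ Suc \<beta> + R s)"
    and growth: "polybdd f (right_halfplane (c - \<delta>) \<inter> {s. \<bar>Im s\<bar> \<ge> 1})"
  shows "S_shape f c \<beta>"
proof -
  let ?S = "right_halfplane (c - \<delta>)"
  \<comment> \<open>One numerator over the common denominator: the contribution of \<open>R\<close>
    vanishes at \<open>c\<close>, so \<open>h\<close> and \<open>g\<close> share their nonzero value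
    there.\<close>
  define h where "h = (\<lambda>s. g s + R s * (s - of_real c) ^ Suc \<beta>)"
  have S: "open ?S" "of_real c \<in> ?S"
    using assms(4) open_right_halfplane by auto
  have h: "h holomorphic_on ?S" "h (of_real c) \<noteq> 0"
    using assms by (auto simp: h_def intro!: holomorphic_intros)
  have f_eq: "f s = h s / (s - of_real c) ^ Suc \<beta>" if "s \<noteq> of_real c" for s
    using that by (simp add: f h_def add_divide_distrib)
  have "is_pole (\<lambda>s. h s / (s - of_real c) ^ Suc \<beta>) (of_real c)"
    by (rule is_pole_basic[OF h(1) S h(2)]) simp
  moreover have ev: "eventually (\<lambda>s. f s = h s / (s - of_real c) ^ Suc \<beta>) (at (of_real c))"
    using f_eq by (auto simp: eventually_at_filter)
  ultimately have pole: "is_pole f (of_real c)"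
    using is_pole_cong[OF ev refl] by simp
  have zorder: "zorder f (of_real c) = - int (Suc \<beta>)"
  proof (rule zorder_eqI[OF S h])
    fix s assume "s \<noteq> complex_of_real c"
    then show "f s = h s * (s - of_real c) powi - int (Suc \<beta>)"
      unfolding power_int_minus power_int_of_nat by (simp only: f_eq[OF \<open>s \<noteq> of_real c\<close>] divide_inverse)
  qed
  have "g meromorphic_on ?S" "R meromorphic_on ?S"
    using g S by (auto intro!: analytic_on_imp_meromorphic_on simp: analytic_on_open)
  then have "f meromorphic_on ?S"
    unfolding f by (intro meromorphic_intros)
  moreover have "f holomorphic_on ?S - {of_real c}"
    unfolding f using g by (auto intro!: holomorphic_intros intro: holomorphic_on_subset)
  ultimately show ?thesis
    unfolding S_shape_def sole_pole_on_def pole_of_order_def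
    using pole zorder assms(4) poly_growth_Im_on_if_polybdd[OF growth] by auto
qed

theorem theorem6:
  fixes d :: real and b :: nat and F :: "nat \<Rightarrow> real"
  assumes "basic_sequence d b F"
  shows "\<exists>\<Psi>. newton_lifting F d \<Psi> \<and>
     (\<forall>a>d. poly_growth_on \<Psi> {s. Re s \<ge> a}) \<and>
     (if b = 0 \<and> d \<in> \<nat>
      then \<exists>\<delta>>0. \<Psi> holomorphic_on right_halfplane (d - \<delta>) \<and>
                 poly_growth_Im_on \<Psi> (right_halfplane (d - \<delta>))
      else tame \<Psi> d) \<and>
     (\<exists>\<sigma>\<^sub>0 B. 0 < \<sigma>\<^sub>0 \<and> \<sigma>\<^sub>0 < 1 \<and>
        (\<forall>s\<in>right_halfplane (d - \<sigma>\<^sub>0) - {of_real d}.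
           \<Psi> s = falling s (sigma_deg d) *
                   (\<Sum>m\<le>b. tame_coeff d b m * twisted_Gamma (sigma_deg d) m (s - of_real d)) + B s) \<and>
        B holomorphic_on right_halfplane (d - \<sigma>\<^sub>0) \<and>
        (\<forall>x. poly_growth_on B {s. d - \<sigma>\<^sub>0 < Re s \<and> Re s \<le> x}))"
proof -
  define l where "l = sigma_deg d"
  define a where "a = tame_coeff d b"
  define B where "B = newton_regular d b F"
  let ?H = "right_halfplane (d - 1/4)"
  have l: "l \<ge> 1" "real l \<ge> 1"
    using sigma_deg_bounds[of d] by (auto simp: l_def)
  define e :: nat where "e = (if d \<in> \<nat> then 1 else 0)"
  obtain q where q: "q holomorphic_on UNIV" "\<And>S. polybdd q S" "q (of_real d) \<noteq> 0"
      "\<And>s. falling s l = (s - of_real d) ^ e * q s"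
    using falling_sigma_deg_factor[of d] unfolding l_def e_def by metis
  \<comment> \<open>The order of the pole; it is 0 exactly when \<open>b = 0\<close> and
    \<open>d\<close> is a natural number.\<close>
  define p where "p = b + 1 - e"
  have pe: "p + e = b + 1"
    by (simp add: p_def e_def)
  \<comment> \<open>Collects the principal parts
    \<open>(-1) ^ m * fact m / (s - d) ^ (m + 1)\<close> over the denominator
    \<open>(s - d) ^ (b + 1)\<close>, after cancelling the zero of \<open>falling s l\<close>, if
    any.\<close>
  define N where "N = (\<lambda>s. q s * (\<Sum>m\<le>b. a m * ((-1) ^ m * fact m) * (s - of_real d) ^ (b - m)))"
  define R where "R = (\<lambda>s. falling s l * (\<Sum>m\<le>b. a m * (deriv ^^ m) (Gamma_reg (real l)) (s - of_real d)) + B s)"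
  \<comment> \<open>An explicit principal part instead of \<open>newton_sum\<close> or
    \<open>twisted_Gamma\<close>: the integrals of the former need not converge left of
    \<open>d\<close>, and the latter has arbitrary values at its pole. If \<open>p = 0\<close> the
    denominator is 1, and the function is holomorphic at \<open>d\<close> too.\<close>
  define \<Psi> where "\<Psi> = (\<lambda>s. N s / (s - of_real d) ^ p + R s)"

  have B_hol: "B holomorphic_on ?H"
    unfolding B_def by (rule holomorphic_on_subset[OF holomorphic_newton_regular]) auto
  have B_bdd: "polybdd B {s. d - 1/4 < Re s \<and> Re s \<le> x}" for x
    unfolding B_def by (rule polybdd_newton_regular) simp
  have N_hol: "N holomorphic_on S" for S
    unfolding N_def using holomorphic_on_subset[OF q(1)] by (intro holomorphic_intros) auto
  have N_bdd: "polybdd N S" for S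
    unfolding N_def by (intro polybdd_mult polybdd_sum polybdd_power polybdd_diff polybdd_const polybdd_id q)
  have R_hol: "R holomorphic_on ?H"
    unfolding R_def
    by (intro holomorphic_intros holomorphic_falling B_hol
        holomorphic_on_subset[OF holomorphic_higher_deriv_Gamma_reg_shift[OF l(2)]]) auto
  have R_bdd: "polybdd R {s. d - 1/4 < Re s \<and> Re s \<le> x}" for x
    unfolding R_def
    by (intro polybdd_add polybdd_mult polybdd_sum polybdd_const polybdd_falling B_bdd
        polybdd_higher_deriv_Gamma_reg_shift l)
  \<comment> \<open>Every term with \<open>m < b\<close> contains a positive power of
    \<open>s - d\<close>; only the leading one survives.\<close>
  have N_d: "N (of_real d) \<noteq> 0"
  proof -
    have "(\<Sum>m\<le>b. a m * ((-1) ^ m * fact m) * (of_real d - of_real d) ^ (b - m)) =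
        (\<Sum>m\<in>{b}. a m * ((-1) ^ m * fact m) * (of_real d - complex_of_real d) ^ (b - m))"
      by (intro sum.mono_neutral_right) auto
    then show ?thesis
      using q(3) tame_coeff_top_nonzero by (simp add: N_def a_def)
  qed
  have \<Psi>_eq: "\<Psi> s = falling s l * (\<Sum>m\<le>b. a m * (deriv ^^ m) (scaled_Gamma (real l)) (s - of_real d)) + B s"
    if "s \<in> ?H - {of_real d}" for s
  proof -
    define x where "x = s - of_real d"
    have x: "x \<noteq> 0" "Re x > -1"
      using that by (auto simp: x_def)
    have "falling s l * (a m * ((-1) ^ m * fact m / x ^ Suc m)) =
        q s * (a m * ((-1) ^ m * fact m) * x ^ (b - m)) / x ^ p" if "m \<le> b" for m
    proof -
      have "x ^ e * x ^ p = x ^ (b - m) * x ^ Suc m"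
        using pe that by (simp add: add.commute flip: power_add power_Suc)
      then have "x ^ e / x ^ Suc m = x ^ (b - m) / x ^ p"
        using x by (simp add: frac_eq_eq)
      moreover have "falling s l * (a m * ((-1) ^ m * fact m / x ^ Suc m)) =
          q s * (a m * ((-1) ^ m * fact m)) * (x ^ e / x ^ Suc m)"
        using q(4)[of s] by (simp add: x_def)
      ultimately show ?thesis
        by simp
    qed
    then have "falling s l * (\<Sum>m\<le>b. a m * ((-1) ^ m * fact m / x ^ Suc m)) = N s / x ^ p"
      unfolding N_def x_def [symmetric] sum_distrib_left sum_divide_distrib by (intro sum.cong) auto
    moreover have "(\<Sum>m\<le>b. a m * (deriv ^^ m) (scaled_Gamma (real l)) x) =
        (\<Sum>m\<le>b. a m * ((-1) ^ m * fact m / x ^ Suc m)) + (\<Sum>m\<le>b. a m * (deriv ^^ m) (Gamma_reg (real l)) x)"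
      unfolding higher_deriv_scaled_Gamma_reg[OF l(2) x(2,1)] by (simp add: ring_distribs sum.distrib)
    ultimately show ?thesis
      by (simp add: \<Psi>_def R_def ring_distribs flip: x_def)
  qed
  have \<Psi>_sum: "\<Psi> s = newton_sum d b F s" if "Re s > d" for s
  proof -
    have "s \<in> ?H - {of_real d}"
      using that by auto
    then show ?thesis
      using newton_sum_eq[OF that] \<Psi>_eq by (simp add: a_def B_def l_def)
  qed
  have \<Psi>_hol: "\<Psi> holomorphic_on right_halfplane d"
    by (rule holomorphic_transform[OF holomorphic_newton_sum]) (simp add: \<Psi>_sum)
  have \<Psi>_bdd: "polybdd \<Psi> {s. Re s \<ge> y}" if "y > d" for y
    using polybdd_newton_sum[OF that] by (rule polybdd_cong[THEN iffD2, rotated]) (use \<Psi>_sum that in auto)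
  have \<Psi>_bdd_Im: "polybdd \<Psi> (?H \<inter> {s. \<bar>Im s\<bar> \<ge> 1})"
  proof -
    \<comment> \<open>The strip bounds on \<open>N\<close> and \<open>R\<close> meet the halfplane
      bound on \<open>\<Psi>\<close> at \<open>Re s = d + 1\<close>. On the strip,
      \<open>|Im s| >= 1\<close> keeps the denominator at least 1 in norm.\<close>
    let ?T = "{s. d - 1/4 < Re s \<and> Re s \<le> d + 1} \<inter> {s. \<bar>Im s\<bar> \<ge> 1}"
    have "polybdd (\<lambda>s. 1 / (s - of_real d) ^ p) ?T"
    proof (rule polybdd_bounded[of _ _ 1])
      fix s assume "s \<in> ?T"
      then have "1 \<le> norm (s - of_real d)"
        using abs_Im_le_cmod[of "s - of_real d"] by simp
      then show "norm (1 / (s - of_real d) ^ p) \<le> 1"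
        using one_le_power[of "norm (s - of_real d)" p] by (simp add: norm_divide norm_power divide_le_eq_1_pos less_le_trans[OF zero_less_one])
    qed
    then have "polybdd (\<lambda>s. N s * (1 / (s - of_real d) ^ p) + R s) ?T"
      using R_bdd by (intro polybdd_add polybdd_mult N_bdd) (auto intro: polybdd_subset)
    then have "polybdd \<Psi> ?T"
      by (simp add: \<Psi>_def)
    then have "polybdd \<Psi> (?T \<union> {s. Re s \<ge> d + 1})"
      using \<Psi>_bdd by (intro polybdd_Un) auto
    then show ?thesis
      by (rule polybdd_subset) auto
  qed
  have lifting: "newton_lifting F d \<Psi>"
    using newton_series_sums[OF assms] \<Psi>_sum \<Psi>_hol by (intro newton_lifting_if_sums) auto
  have growth: "\<forall>y>d. poly_growth_on \<Psi> {s. Re s \<ge> y}"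
    using \<Psi>_bdd poly_growth_on_if_polybdd by blast
  have tame: "if b = 0 \<and> d \<in> \<nat>
      then \<exists>\<delta>>0. \<Psi> holomorphic_on right_halfplane (d - \<delta>) \<and>
                 poly_growth_Im_on \<Psi> (right_halfplane (d - \<delta>))
      else tame \<Psi> d"
  proof (cases "b = 0 \<and> d \<in> \<nat>")
    case True
    then have "\<Psi> = (\<lambda>s. N s + R s)"
      by (simp add: \<Psi>_def p_def e_def)
    then have "\<Psi> holomorphic_on ?H"
      using N_hol R_hol by (auto intro!: holomorphic_intros)
    then show ?thesis
      using True poly_growth_Im_on_if_polybdd[OF \<Psi>_bdd_Im] by (auto intro!: exI[of _ "1/4"])
  next
    case False
    then have p: "p = Suc (p - 1)"
      by (auto simp: p_def e_def)
    have "S_shape \<Psi> d (p - 1)"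
      using N_hol R_hol N_d _ _ \<Psi>_bdd_Im by (rule S_shapeI) (use p in \<open>auto simp: \<Psi>_def\<close>)
    then show ?thesis
      using False \<Psi>_hol growth by (auto simp: tame_def)
  qed
  have formula: "\<Psi> s = falling s (sigma_deg d) *
      (\<Sum>m\<le>b. tame_coeff d b m * twisted_Gamma (sigma_deg d) m (s - of_real d)) + B s"
    if "s \<in> ?H - {of_real d}" for s
  proof -
    \<comment> \<open>To the right of \<open>d - 1/4\<close> the only nonpositive integer that
      \<open>s - d\<close> can equal is 0, so away from \<open>d\<close> the value of
      \<open>twisted_Gamma\<close> is determined.\<close>
    have "s - of_real d \<notin> \<int>\<^sub>\<le>\<^sub>0"
    proof
      assume "s - of_real d \<in> \<int>\<^sub>\<le>\<^sub>0"
      then obtain n where n: "s - of_real d = of_int n" "n \<le> 0"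
        by (auto elim!: nonpos_Ints_cases)
      have "Re (s - of_real d) > -1"
        using that by simp
      then have "n = 0"
        using n by simp
      then show False
        using n that by simp
    qed
    then show ?thesis
      using \<Psi>_eq[OF that] twisted_Gamma_eq[OF l(1)] by (simp add: l_def a_def)
  qed
  show ?thesis
    using lifting growth tame formula B_hol poly_growth_on_if_polybdd[OF B_bdd]
    by (intro exI[of _ \<Psi>] exI[of _ "1/4"] exI[of _ B] conjI) auto
qed

end
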